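(* Let $L_1=L_{\mathbf u_1,\mathbf v_1}$ and $L_2=L_{\mathbf u_2,\mathbf v_2}$ be two supergeodesics in the super hyperbolic plane $\mathbb{H}_s$ that are parallel and not ultraparallel. Then $L_1$ and $L_2$ admit a unique common perpendicular supergeodesic.
   Context: Supernumbers: $\mathbb{R}_*=\mathbb{R}_*[0]\oplus\mathbb{R}_*[1]$ is the $\mathbb{Z}/2$-graded algebra over $\mathbb{R}$ with central unit $1$ of degree zero and countably infinitely many anticommuting generators $e_1,e_2,\dots$ of degree one (each element is a finite sum of finite products). Elements of $\mathbb{R}_*[0]$ are even, those of $\mathbb{R}_*[1]$ odd. The body $a_\#\in\mathbb{R}$ of $a$ is its constant term, and $a-a_\#$ is nilpotent. Real-analytic functions are extended to supernumbers by Taylor series. Inequalities between supernumbers are inequalities between their bodies. Super Minkowski space: $\mathbb{R}^{2,1|2}=\{(x_1,x_2,y\,|\,\phi,\psi): x_1,x_2,y\in\mathbb{R}_*[0],\ \phi,\psi\in\mathbb{R}_*[1]\}$ with the pairing $$\langle (x_1,x_2,y|\phi,\psi),(x_1',x_2',y'|\phi',\psi')\rangle=\tfrac12(x_1x_2'+x_1'x_2)-yy'+\phi\psi'+\phi'\psi .$$ The super hyperbolic plane is $\mathbb{H}_s=\{\mathbf x:\langle\mathbf x,\mathbf x\rangle=1,\ x_1+x_2>0\}$, the super hyperboloid of one sheet is $\mathbb{D}_s=\{\mathbf h:\langle\mathbf h,\mathbf h\rangle=-1\}$, and the positive light cone is $\mathcal{L}^+=\{\mathbf x:\langle\mathbf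 x,\mathbf x\rangle=0,\ x_1+x_2>0\}$. Supergeodesics: for $\mathbf u\in\mathbb{H}_s$, $\mathbf v\in\mathbb{D}_s$ with $\langle\mathbf u,\mathbf v\rangle=0$, the supergeodesic they determine is $$L_{\mathbf u,\mathbf v}=\{\cosh s\,\mathbf u+\sinh s\,\mathbf v: s\in\mathbb{R}\}\subset\mathbb{H}_s,$$ parametrized by arc length, with unit tangent vector $\sinh s\,\mathbf u+\cosh s\,\mathbf v$ at the point with parameter $s$. Its asymptotes are the rays from the origin containing $\mathbf u+\mathbf v$ and $\mathbf u-\mathbf v$, both of which lie in $\mathcal{L}^+$. Two supergeodesics are parallel if they do not intersect, and they are furthermore ultraparallel if they share an asymptotic ray in $\mathcal{L}^+$. Two supergeodesics are perpendicular if they meet at a point of $\mathbb{H}_s$ at which their unit tangent vectors have pairing zero.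
   Formalization: The arc-length parameter s ranges over all even supernumbers rather than ℝ, and "do not intersect" and "share an asymptotic ray" are conditions on the bodies of the supergeodesics and rays; read literally, either with real s or with plain set disjointness, the claim has counterexamples. *)

theory Defs
  imports "HOL-Analysis.Analysis"
begin

section \<open>Supernumbers\<close>

text \<open>
  The real Grassmann algebra on generators indexed by \<^typ>\<open>nat\<close>, in its monomial basis: the
  finite set \<open>A = {i1 < ... < ik}\<close> stands for the monomial \<open>e_i1 * ... * e_ik\<close> (and \<open>{}\<close> for
  \<open>1\<close>), and \<open>coeff a A\<close> is the coefficient of that monomial in \<open>a\<close>.
\<close>

typedef supernumber =
  "{f :: nat set \<Rightarrow> real. finite {A. f A \<noteq> 0} \<and> (\<forall>A. f A \<noteq> 0 \<longrightarrow> finite A)}"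
  morphisms coeff Abs_supernumber
  by (rule exI[of _ "\<lambda>_. 0"]) auto

setup_lifting type_definition_supernumber

lemma supernumber_eqI: "(\<And>A. coeff a A = coeff b A) \<Longrightarrow> a = b"
  by transfer (rule ext)

lemma finite_support: "finite {A. coeff a A \<noteq> 0}"
  by transfer auto

lemma coeff_infinite: "infinite A \<Longrightarrow> coeff a A = 0"
  by transfer auto

text \<open>The sign of the permutation that sorts the concatenation of the increasing words \<open>A\<close>, \<open>B\<close>.\<close>

definition shuffle_sign :: "nat set \<Rightarrow> nat set \<Rightarrow> real" where
  "shuffle_sign A B = (-1) ^ card {(a, b) \<in> A \<times> B. b < a}"

lemma shuffle_sign_empty [simp]: "shuffle_sign {} B = 1" "shuffle_sign A {} = 1"
  by (simp_all add: shuffle_sign_def)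

lemma shuffle_sign_Un_left:
  assumes "finite A" "finite B" "finite C" "A \<inter> B = {}"
  shows "shuffle_sign (A \<union> B) C = shuffle_sign A C * shuffle_sign B C"
proof -
  have "{(a, b) \<in> (A \<union> B) \<times> C. b < a} = {(a, b) \<in> A \<times> C. b < a} \<union> {(a, b) \<in> B \<times> C. b < a}"
    by auto
  moreover have "finite {(a, b) \<in> A \<times> C. b < a}" "finite {(a, b) \<in> B \<times> C. b < a}"
    using assms by (auto intro: finite_subset[of _ "A \<times> C"] finite_subset[of _ "B \<times> C"])
  ultimately have "card {(a, b) \<in> (A \<union> B) \<times> C. b < a}
      = card {(a, b) \<in> A \<times> C. b < a} + card {(a, b) \<in> B \<times> C. b < a}"
    using assms(4) by (subst card_Un_disjoint[symmetric]) auto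
  then show ?thesis by (simp add: shuffle_sign_def power_add)
qed

lemma shuffle_sign_Un_right:
  assumes "finite A" "finite B" "finite C" "B \<inter> C = {}"
  shows "shuffle_sign A (B \<union> C) = shuffle_sign A B * shuffle_sign A C"
proof -
  have "{(a, b) \<in> A \<times> (B \<union> C). b < a} = {(a, b) \<in> A \<times> B. b < a} \<union> {(a, b) \<in> A \<times> C. b < a}"
    by auto
  moreover have "finite {(a, b) \<in> A \<times> B. b < a}" "finite {(a, b) \<in> A \<times> C. b < a}"
    using assms by (auto intro: finite_subset[of _ "A \<times> B"] finite_subset[of _ "A \<times> C"])
  ultimately have "card {(a, b) \<in> A \<times> (B \<union> C). b < a}
      = card {(a, b) \<in> A \<times> B. b < a} + card {(a, b) \<in> A \<times> C. b < a}"
    using assms(4) by (subst card_Un_disjoint[symmetric]) auto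
  then show ?thesis by (simp add: shuffle_sign_def power_add)
qed

instantiation supernumber :: real_vector
begin

lift_definition zero_supernumber :: supernumber is "\<lambda>_. 0" by simp

lift_definition plus_supernumber :: "supernumber \<Rightarrow> supernumber \<Rightarrow> supernumber"
  is "\<lambda>f g A. f A + g A"
proof -
  fix f g :: "nat set \<Rightarrow> real"
  assume f: "finite {A. f A \<noteq> 0} \<and> (\<forall>A. f A \<noteq> 0 \<longrightarrow> finite A)"
    and g: "finite {A. g A \<noteq> 0} \<and> (\<forall>A. g A \<noteq> 0 \<longrightarrow> finite A)"
  have "finite {A. f A + g A \<noteq> 0}"
    by (rule finite_subset[of _ "{A. f A \<noteq> 0} \<union> {A. g A \<noteq> 0}"]) (use f g in auto)
  moreover have "\<forall>A. f A + g A \<noteq> 0 \<longrightarrow> finite A"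
    using f g by (metis add_0)
  ultimately show "finite {A. f A + g A \<noteq> 0} \<and> (\<forall>A. f A + g A \<noteq> 0 \<longrightarrow> finite A)" by blast
qed

lift_definition uminus_supernumber :: "supernumber \<Rightarrow> supernumber" is "\<lambda>f A. - f A" by simp

definition minus_supernumber :: "supernumber \<Rightarrow> supernumber \<Rightarrow> supernumber" where
  "minus_supernumber a b = a + (- b)"

lift_definition scaleR_supernumber :: "real \<Rightarrow> supernumber \<Rightarrow> supernumber"
  is "\<lambda>r f A. r * f A"
proof -
  fix r :: real and f :: "nat set \<Rightarrow> real"
  assume f: "finite {A. f A \<noteq> 0} \<and> (\<forall>A. f A \<noteq> 0 \<longrightarrow> finite A)"
  have "finite {A. r * f A \<noteq> 0}"
    by (rule finite_subset[of _ "{A. f A \<noteq> 0}"]) (use f in auto)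
  then show "finite {A. r * f A \<noteq> 0} \<and> (\<forall>A. r * f A \<noteq> 0 \<longrightarrow> finite A)"
    using f by auto
qed

instance
  by standard
    (simp add: minus_supernumber_def | transfer; simp add: fun_eq_iff algebra_simps)+

end

lemma coeff_zero [simp]: "coeff 0 A = 0" by transfer simp
lemma coeff_add [simp]: "coeff (a + b) A = coeff a A + coeff b A" by transfer simp
lemma coeff_uminus [simp]: "coeff (- a) A = - coeff a A" by transfer simp
lemma coeff_diff [simp]: "coeff (a - b) A = coeff a A - coeff b A"
  by (simp only: minus_supernumber_def coeff_add coeff_uminus)
lemma coeff_scaleR [simp]: "coeff (r *\<^sub>R a) A = r * coeff a A" by transfer simp

text \<open>
  In the product below the sum is over all ways to split \<open>C\<close> into two factors; for infinite \<open>C\<close>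
  it is a sum over an infinite set and hence \<open>0\<close>, as required.
\<close>

instantiation supernumber :: real_algebra_1
begin

lift_definition one_supernumber :: supernumber is "\<lambda>A. if A = {} then 1 else 0"
  by simp

lift_definition times_supernumber :: "supernumber \<Rightarrow> supernumber \<Rightarrow> supernumber"
  is "\<lambda>f g C. \<Sum>A\<in>Pow C. shuffle_sign A (C - A) * f A * g (C - A)"
proof -
  fix f g :: "nat set \<Rightarrow> real"
  let ?h = "\<lambda>C. \<Sum>A\<in>Pow C. shuffle_sign A (C - A) * f A * g (C - A)"
  assume f: "finite {A. f A \<noteq> 0} \<and> (\<forall>A. f A \<noteq> 0 \<longrightarrow> finite A)"
    and g: "finite {A. g A \<noteq> 0} \<and> (\<forall>A. g A \<noteq> 0 \<longrightarrow> finite A)"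
  have *: "\<exists>A B. f A \<noteq> 0 \<and> g B \<noteq> 0 \<and> C = A \<union> B" if C: "?h C \<noteq> 0" for C
  proof -
    obtain A where "A \<in> Pow C" "shuffle_sign A (C - A) * f A * g (C - A) \<noteq> 0"
      using C by (meson sum.neutral)
    then show ?thesis by (intro exI[of _ A] exI[of _ "C - A"]) auto
  qed
  have "finite {C. ?h C \<noteq> 0}"
  proof (rule finite_subset)
    show "{C. ?h C \<noteq> 0} \<subseteq> (\<lambda>(A, B). A \<union> B) ` ({A. f A \<noteq> 0} \<times> {B. g B \<noteq> 0})"
    proof
      fix C assume "C \<in> {C. ?h C \<noteq> 0}"
      then obtain A B where "f A \<noteq> 0" "g B \<noteq> 0" "C = A \<union> B" using * by blast
      then show "C \<in> (\<lambda>(A, B). A \<union> B) ` ({A. f A \<noteq> 0} \<times> {B. g B \<noteq> 0})"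
        by (intro image_eqI[of _ _ "(A, B)"]) auto
    qed
    show "finite ((\<lambda>(A, B). A \<union> B) ` ({A. f A \<noteq> 0} \<times> {B. g B \<noteq> 0}))"
      using f g by (intro finite_imageI finite_cartesian_product) blast+
  qed
  moreover have "finite C" if "?h C \<noteq> 0" for C
    using *[OF that] f g by (metis finite_Un)
  ultimately show "finite {C. ?h C \<noteq> 0} \<and> (\<forall>C. ?h C \<noteq> 0 \<longrightarrow> finite C)" by blast
qed

lemma coeff_one: "coeff 1 A = (if A = {} then 1 else 0)" by transfer simp

lemma coeff_times:
  "coeff (a * b) C = (\<Sum>A\<in>Pow C. shuffle_sign A (C - A) * coeff a A * coeff b (C - A))"
  by transfer simp

instance
proof
  fix a b c :: supernumber and r :: real
  show "a * b * c = a * (b * c)"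
  proof (rule supernumber_eqI)
    fix D
    show "coeff (a * b * c) D = coeff (a * (b * c)) D"
    proof (cases "finite D")
      case True
      have "coeff (a * b * c) D = (\<Sum>C\<in>Pow D. \<Sum>A\<in>Pow C. shuffle_sign C (D - C) *
              (shuffle_sign A (C - A) * coeff a A * coeff b (C - A)) * coeff c (D - C))"
        by (simp add: coeff_times sum_distrib_left sum_distrib_right)
      also have "\<dots> = (\<Sum>(C, A)\<in>Sigma (Pow D) Pow. shuffle_sign C (D - C) *
              (shuffle_sign A (C - A) * coeff a A * coeff b (C - A)) * coeff c (D - C))"
        using True by (intro sum.Sigma) (auto intro: finite_subset)
      also have "\<dots> = (\<Sum>(A, B)\<in>Sigma (Pow D) (\<lambda>A. Pow (D - A)). shuffle_sign A (D - A) *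
              coeff a A * (shuffle_sign B (D - A - B) * coeff b B * coeff c (D - A - B)))"
      proof (rule sum.reindex_bij_witness[where
            i = "\<lambda>(A, B). (A \<union> B, A)" and j = "\<lambda>(C, A). (A, C - A)"], goal_cases)
        case (5 p)
        obtain C A where p: "p = (C, A)" and CA: "A \<subseteq> C" "C \<subseteq> D" using 5 by auto
        have fin: "finite A" "finite (C - A)" "finite (D - C)"
          using True CA by (auto intro: finite_subset)
        have eq: "D - A = (C - A) \<union> (D - C)" "D - A - (C - A) = D - C" "C = A \<union> (C - A)"
          using CA by auto
        have 1: "shuffle_sign C (D - C) = shuffle_sign A (D - C) * shuffle_sign (C - A) (D - C)"
          using shuffle_sign_Un_left[OF fin] eq(3) by (metis Diff_disjoint)
        have 2: "shuffle_sign A (D - A) = shuffle_sign A (C - A) * shuffle_sign A (D - C)"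
          unfolding eq(1) by (rule shuffle_sign_Un_right) (use fin in auto)
        show ?case unfolding p by (simp add: 1 2 eq(2))
      qed (auto simp: Un_Diff)
      also have "\<dots> = (\<Sum>A\<in>Pow D. \<Sum>B\<in>Pow (D - A). shuffle_sign A (D - A) *
              coeff a A * (shuffle_sign B (D - A - B) * coeff b B * coeff c (D - A - B)))"
        using True by (intro sum.Sigma[symmetric]) auto
      also have "\<dots> = coeff (a * (b * c)) D"
        by (simp add: coeff_times sum_distrib_left)
      finally show ?thesis .
    qed (simp add: coeff_infinite)
  qed
  show "(a + b) * c = a * c + b * c"
    by (rule supernumber_eqI) (simp add: coeff_times distrib_left distrib_right sum.distrib)
  show "a * (b + c) = a * b + a * c"
    by (rule supernumber_eqI) (simp add: coeff_times distrib_left sum.distrib)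
  show "r *\<^sub>R a * b = r *\<^sub>R (a * b)"
    by (rule supernumber_eqI) (simp add: coeff_times sum_distrib_left mult_ac)
  show "a * r *\<^sub>R b = r *\<^sub>R (a * b)"
    by (rule supernumber_eqI) (simp add: coeff_times sum_distrib_left mult_ac)
  show "1 * a = a"
  proof (rule supernumber_eqI)
    fix C
    show "coeff (1 * a) C = coeff a C"
    proof (cases "finite C")
      case True
      have "coeff (1 * a) C = (\<Sum>A\<in>Pow C. if A = {} then coeff a C else 0)"
        unfolding coeff_times by (intro sum.cong) (auto simp: coeff_one)
      then show ?thesis using True by simp
    qed (simp add: coeff_infinite)
  qed
  show "a * 1 = a"
  proof (rule supernumber_eqI)
    fix C
    show "coeff (a * 1) C = coeff a C"
    proof (cases "finite C")
      case True
      have "coeff (a * 1) C = (\<Sum>A\<in>Pow C. if A = C then coeff a C else 0)"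
        unfolding coeff_times by (intro sum.cong) (auto simp: coeff_one)
      then show ?thesis using True by simp
    qed (simp add: coeff_infinite)
  qed
  show "(0 :: supernumber) \<noteq> 1"
    by (metis coeff_one coeff_zero zero_neq_one)
qed

end

definition even_supernumbers :: "supernumber set" where
  "even_supernumbers = {a. \<forall>A. coeff a A \<noteq> 0 \<longrightarrow> even (card A)}"

definition odd_supernumbers :: "supernumber set" where
  "odd_supernumbers = {a. \<forall>A. coeff a A \<noteq> 0 \<longrightarrow> odd (card A)}"

lift_definition gen :: "nat \<Rightarrow> supernumber" is "\<lambda>i A. if A = {i} then 1 else 0"
  by simp

lemma coeff_gen: "coeff (gen i) A = (if A = {i} then 1 else 0)" by transfer simp

lemma gen_mult_gen: "coeff (gen i * gen j) C =
    (if C = {i, j} \<and> i \<noteq> j then (if j < i then -1 else 1) else 0)"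
proof (cases "finite C")
  case True
  let ?s = "shuffle_sign {i} (C - {i}) * (if C - {i} = {j} then 1 else 0)"
  have "coeff (gen i * gen j) C = (\<Sum>A\<in>Pow C. if A = {i} then ?s else 0)"
    unfolding coeff_times coeff_gen by (rule sum.cong) simp_all
  also have "\<dots> = (if {i} \<in> Pow C then ?s else 0)"
    using True by (intro sum.delta) simp
  also have "\<dots> = (if C = {i, j} \<and> i \<noteq> j then shuffle_sign {i} {j} else 0)"
  proof (cases "i \<in> C \<and> C - {i} = {j}")
    case True
    then have "C = {i, j} \<and> i \<noteq> j" by blast
    then show ?thesis using True by simp
  next
    case False
    then have "\<not> (C = {i, j} \<and> i \<noteq> j)" by blast
    then show ?thesis using False by simp
  qed
  also have "shuffle_sign {i} {j} = (if j < i then -1 else 1)"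
  proof -
    have "{(a, b). (a, b) \<in> {i} \<times> {j} \<and> b < a} = (if j < i then {(i, j)} else {})" by auto
    then show ?thesis unfolding shuffle_sign_def by simp
  qed
  finally show ?thesis .
next
  case False
  then have "C \<noteq> {i, j}" by blast
  then show ?thesis using False by (simp add: coeff_infinite)
qed

lemma gen_anticommute: "gen i * gen j = - (gen j * gen i)"
proof (rule supernumber_eqI)
  fix C :: "nat set"
  have "{i, j} = {j, i}" by blast
  then show "coeff (gen i * gen j) C = coeff (- (gen j * gen i)) C"
    unfolding coeff_uminus gen_mult_gen by (cases i j rule: linorder_cases) simp_all
qed

definition body :: "supernumber \<Rightarrow> real" where
  "body a = coeff a {}"

definition soul :: "supernumber \<Rightarrow> supernumber" where
  "soul a = a - of_real (body a)"

lemma soul_nilpotent: "\<exists>N. \<forall>n\<ge>N. soul a ^ n = 0"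
proof -
  define V where "V = \<Union> {A. coeff (soul a) A \<noteq> 0}"
  have V: "finite V"
    unfolding V_def using finite_support[of "soul a"] coeff_infinite by blast
  have 0: "coeff (soul a) {} = 0"
    by (simp add: soul_def body_def of_real_def coeff_one)
  have "A \<subseteq> V \<and> n \<le> card A" if "coeff (soul a ^ n) A \<noteq> 0" for n A
    using that
  proof (induction n arbitrary: A)
    case 0
    then show ?case by (simp add: coeff_one split: if_splits)
  next
    case (Suc n)
    have "finite A" using Suc.prems coeff_infinite by blast
    obtain B where B: "B \<in> Pow A"
      "shuffle_sign B (A - B) * coeff (soul a) B * coeff (soul a ^ n) (A - B) \<noteq> 0"
      using Suc.prems unfolding power_Suc coeff_times by (meson sum.neutral)
    then have sB: "coeff (soul a) B \<noteq> 0" by auto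
    then have "B \<subseteq> V" "B \<noteq> {}" using 0 unfolding V_def by auto
    moreover have "A - B \<subseteq> V" "n \<le> card (A - B)" using B Suc.IH by auto
    moreover have "card A = card B + card (A - B)"
      using B \<open>finite A\<close> by (metis PowD card_Diff_subset card_mono finite_subset le_add_diff_inverse)
    moreover have "card B > 0"
      using \<open>B \<noteq> {}\<close> B \<open>finite A\<close> by (metis PowD card_gt_0_iff finite_subset)
    ultimately show ?case by auto
  qed
  then have "soul a ^ n = 0" if "n > card V" for n
    using that V by (intro supernumber_eqI) (metis card_mono coeff_zero leD le_trans)
  then show ?thesis by (meson Suc_le_lessD)
qed

text \<open>
  The extension of a real-analytic function to supernumbers by its Taylor series at the body; only
  finitely many terms are nonzero, and exactly these are summed.
\<close>

definition super_ext :: "(real \<Rightarrow> real) \<Rightarrow> supernumber \<Rightarrow> supernumber" where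
  "super_ext f a =
     (\<Sum>n | soul a ^ n \<noteq> 0. ((deriv ^^ n) f (body a) / fact n) *\<^sub>R soul a ^ n)"

lemma finite_soul_powers: "finite {n. soul a ^ n \<noteq> 0}"
proof -
  obtain N where "\<forall>n\<ge>N. soul a ^ n = 0" using soul_nilpotent by blast
  then have "{n. soul a ^ n \<noteq> 0} \<subseteq> {..<N}" by (auto simp: not_le[symmetric])
  then show ?thesis by (rule finite_subset) simp
qed


section \<open>Super Minkowski space\<close>

type_synonym superpoint =
  "supernumber \<times> supernumber \<times> supernumber \<times> supernumber \<times> supernumber"

definition minkowski :: "superpoint set" where
  "minkowski = even_supernumbers \<times> even_supernumbers \<times> even_supernumbers
                 \<times> odd_supernumbers \<times> odd_supernumbers"

fun pairing :: "superpoint \<Rightarrow> superpoint \<Rightarrow> supernumber" where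
  "pairing (x1, x2, y, \<phi>, \<psi>) (x1', x2', y', \<phi>', \<psi>') =
     (1/2) *\<^sub>R (x1 * x2' + x1' * x2) - y * y' + \<phi> * \<psi>' + \<phi>' * \<psi>"

fun smult :: "supernumber \<Rightarrow> superpoint \<Rightarrow> superpoint" where
  "smult c (x1, x2, y, \<phi>, \<psi>) = (c * x1, c * x2, c * y, c * \<phi>, c * \<psi>)"

text \<open>The bodies of the two odd coordinates are zero and are left out.\<close>

fun body_point :: "superpoint \<Rightarrow> real \<times> real \<times> real" where
  "body_point (x1, x2, y, \<phi>, \<psi>) = (body x1, body x2, body y)"

definition super_H :: "superpoint set" where
  "super_H = {x \<in> minkowski. pairing x x = 1 \<and> (case x of (x1, x2, _) \<Rightarrow> body (x1 + x2) > 0)}"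

definition super_D :: "superpoint set" where
  "super_D = {h \<in> minkowski. pairing h h = - 1}"

definition light_cone :: "superpoint set" where
  "light_cone = {x \<in> minkowski. pairing x x = 0 \<and> (case x of (x1, x2, _) \<Rightarrow> body (x1 + x2) > 0)}"


section \<open>Supergeodesics\<close>

definition frame :: "superpoint \<Rightarrow> superpoint \<Rightarrow> bool" where
  "frame u v \<longleftrightarrow> u \<in> super_H \<and> v \<in> super_D \<and> pairing u v = 0"

definition geo_point :: "superpoint \<Rightarrow> superpoint \<Rightarrow> supernumber \<Rightarrow> superpoint" where
  "geo_point u v s = smult (super_ext cosh s) u + smult (super_ext sinh s) v"

definition geo_tangent :: "superpoint \<Rightarrow> superpoint \<Rightarrow> supernumber \<Rightarrow> superpoint" where
  "geo_tangent u v s = smult (super_ext sinh s) u + smult (super_ext cosh s) v"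

text \<open>
  The arc length \<open>s\<close> is a real coordinate in the sense of supergeometry, that is, it ranges over
  all even supernumbers (as do the coordinates \<open>x1\<close>, \<open>x2\<close>, \<open>y\<close>). With parameters in \<^typ>\<open>real\<close>
  only, a supergeodesic would not even contain the feet of its common perpendiculars, whose
  parameters in general have nonzero soul.
\<close>

definition supergeodesic_of :: "superpoint \<Rightarrow> superpoint \<Rightarrow> superpoint set" where
  "supergeodesic_of u v = {geo_point u v s | s. s \<in> even_supernumbers}"

definition supergeodesic :: "superpoint set \<Rightarrow> bool" where
  "supergeodesic L \<longleftrightarrow> (\<exists>u v. frame u v \<and> L = supergeodesic_of u v)"

definition unit_tangent :: "superpoint set \<Rightarrow> superpoint \<Rightarrow> superpoint \<Rightarrow> bool" where
  "unit_tangent L p t \<longleftrightarrow> (\<exists>u v s. frame u v \<and> L = supergeodesic_of u v \<and> s \<in> even_supernumbers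
                              \<and> p = geo_point u v s \<and> t = geo_tangent u v s)"

definition ray :: "superpoint \<Rightarrow> superpoint set" where
  "ray w = {smult c w | c. c \<in> even_supernumbers \<and> body c > 0}"

definition asymptotic_ray :: "superpoint set \<Rightarrow> superpoint set \<Rightarrow> bool" where
  "asymptotic_ray L R \<longleftrightarrow>
     (\<exists>u v. frame u v \<and> L = supergeodesic_of u v \<and> (R = ray (u + v) \<or> R = ray (u - v)))"

text \<open>
  Being disjoint, and having distinct asymptotes, are conditions of inequality and as such are
  conditions on bodies: supergeodesics are parallel if even their bodies do not meet, and two rays
  are regarded as the same asymptote if they have the same body. It would not be enough to require
  that the sets themselves be disjoint: the supergeodesics of the frames
  \<open>(1, 1, 0 | 0, 0), (1, -1, 0 | 0, 0)\<close> and \<open>(1, 1, 0 | e, 0), (0, 0, 1 | 0, 0)\<close>, where \<open>e\<close> is a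
  generator, are disjoint, but their bodies cross, and there is no common perpendicular.
  Perpendicularity, in contrast, is an equality and is meant exactly.
\<close>

definition parallel :: "superpoint set \<Rightarrow> superpoint set \<Rightarrow> bool" where
  "parallel L L' \<longleftrightarrow> body_point ` L \<inter> body_point ` L' = {}"

definition ultraparallel :: "superpoint set \<Rightarrow> superpoint set \<Rightarrow> bool" where
  "ultraparallel L L' \<longleftrightarrow> parallel L L' \<and>
     (\<exists>R R'. asymptotic_ray L R \<and> asymptotic_ray L' R' \<and> R \<subseteq> light_cone \<and> R' \<subseteq> light_cone
        \<and> body_point ` R = body_point ` R')"

definition perpendicular :: "superpoint set \<Rightarrow> superpoint set \<Rightarrow> bool" where
  "perpendicular L L' \<longleftrightarrow>
     (\<exists>p\<in>super_H. \<exists>t t'. unit_tangent L p t \<and> unit_tangent L' p t' \<and> pairing t t' = 0)"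

end

theory Submission
  imports Defs
begin

text \<open>
  With \<open>x = exp s\<close> and \<open>y = exp t\<close> for the parameters \<open>s\<close> and \<open>t\<close> of a point \<open>p\<^sub>1\<close> of \<open>L\<^sub>1\<close> and a point \<open>p\<^sub>2\<close> of \<open>L\<^sub>2\<close>,
  the pairing \<open>\<langle>p\<^sub>1, p\<^sub>2\<rangle>\<close> is a combination of \<open>x y\<close>, \<open>x / y\<close>, \<open>y / x\<close>, \<open>1 / (x y)\<close>
  whose coefficients are, up to the factor \<open>1/4\<close>, the pairings of the asymptotes. These have positive
  body because no asymptote is shared. A supergeodesic through \<open>p\<^sub>1\<close> and \<open>p\<^sub>2\<close> is perpendicular
  to \<open>L\<^sub>1\<close> and \<open>L\<^sub>2\<close> iff \<open>(p\<^sub>1, p\<^sub>2)\<close> is a critical point of the pairing, which amounts to equations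
  \<open>\<alpha> x\<^sup>2 y\<^sup>2 = \<delta>\<close> and \<open>\<beta> x\<^sup>2 = \<gamma> y\<^sup>2\<close>. Even supernumbers of positive body have logarithms and
  unique square roots of positive body, so there is exactly one critical point. Since the bodies
  of the supergeodesics are disjoint, \<open>p\<^sub>1\<close> and \<open>p\<^sub>2\<close> have distinct bodies and hence lie on exactly one
  supergeodesic.
\<close>

section \<open>The commutative algebra of even supernumbers\<close>

text \<open>Since \<open>A\<close> and \<open>B\<close> are disjoint, each pair in
  \<open>A \<times> B\<close> is an inversion for exactly one of the two orders of concatenation, so
  the two inversion counts add up to \<open>card A * card B\<close>.\<close>

lemma shuffle_sign_commute:
  assumes "finite A" "finite B" "A \<inter> B = {}"
  shows "shuffle_sign A B = (-1) ^ (card A * card B) * shuffle_sign B A"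
proof -
  define P where "P = {(a, b) \<in> A \<times> B. b < a}"
  define Q where "Q = {(a, b) \<in> A \<times> B. a < b}"
  define R where "R = {(b, a) \<in> B \<times> A. a < b}"
  have "a < b \<or> b < a" if "a \<in> A" "b \<in> B" for a b
    using that assms(3) by (metis disjoint_iff linorder_neqE_nat)
  then have AB: "A \<times> B = P \<union> Q" unfolding P_def Q_def by blast
  then have "finite P" "finite Q"
    using assms by (metis finite_cartesian_product finite_Un)+
  moreover have "P \<inter> Q = {}" by (auto simp: P_def Q_def)
  ultimately have "card A * card B = card P + card Q"
    using AB card_Un_disjoint[of P Q] by (simp flip: card_cartesian_product)
  moreover have "Q = prod.swap ` R" by (force simp: Q_def R_def)
  then have "card Q = card R" by (simp add: card_image)
  ultimately have sum: "card A * card B = card P + card R" by simp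
  have sgn: "shuffle_sign A B = (-1) ^ card P" "shuffle_sign B A = (-1) ^ card R"
    by (simp_all only: shuffle_sign_def P_def R_def)
  show ?thesis
    unfolding sum sgn by (simp add: power_add mult.assoc flip: power_mult_distrib)
qed

text \<open>Moving a monomial of even degree past any disjoint monomial costs an even number of
  transpositions; passing to complements in \<open>Pow C\<close> then exchanges the two
  factors.\<close>

lemma even_supernumber_central:
  assumes "a \<in> even_supernumbers"
  shows "a * b = b * a"
proof (rule supernumber_eqI)
  fix C
  show "coeff (a * b) C = coeff (b * a) C"
  proof (cases "finite C")
    case True
    have "coeff (a * b) C = (\<Sum>A\<in>Pow C. shuffle_sign (C - A) A * coeff b (C - A) * coeff a A)"
      unfolding coeff_times
    proof (rule sum.cong[OF refl])
      fix A assume A: "A \<in> Pow C"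
      then have "finite A" using True finite_subset by auto
      then have "shuffle_sign A (C - A) = shuffle_sign (C - A) A" if "coeff a A \<noteq> 0"
        using shuffle_sign_commute[of A "C - A"] that assms True
        by (auto simp: even_supernumbers_def)
      then show "shuffle_sign A (C - A) * coeff a A * coeff b (C - A) =
          shuffle_sign (C - A) A * coeff b (C - A) * coeff a A"
        by auto
    qed
    also have "\<dots> = coeff (b * a) C"
      unfolding coeff_times
      by (rule sum.reindex_bij_witness[of _ "\<lambda>A. C - A" "\<lambda>A. C - A"])
        (auto simp: double_diff)
    finally show ?thesis .
  qed (simp add: coeff_infinite)
qed

lemma coeff_times_nonzeroE:
  assumes "coeff (a * b) C \<noteq> 0"
  obtains A B where "coeff a A \<noteq> 0" "coeff b B \<noteq> 0" "card C = card A + card B"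
proof -
  have C: "finite C" using assms coeff_infinite by blast
  obtain A where A: "A \<in> Pow C" "shuffle_sign A (C - A) * coeff a A * coeff b (C - A) \<noteq> 0"
    using assms unfolding coeff_times by (meson sum.neutral)
  have "card C = card A + card (C - A)"
    using A C by (metis PowD card_Diff_subset card_mono finite_subset le_add_diff_inverse)
  with A show ?thesis by (intro that[of A "C - A"]) auto
qed

lemma even_zero: "0 \<in> even_supernumbers"
  and even_one: "1 \<in> even_supernumbers"
  and even_add: "a \<in> even_supernumbers \<Longrightarrow> b \<in> even_supernumbers \<Longrightarrow> a + b \<in> even_supernumbers"
  and even_uminus: "a \<in> even_supernumbers \<Longrightarrow> - a \<in> even_supernumbers"
  and even_diff: "a \<in> even_supernumbers \<Longrightarrow> b \<in> even_supernumbers \<Longrightarrow> a - b \<in> even_supernumbers"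
  and even_scaleR: "a \<in> even_supernumbers \<Longrightarrow> r *\<^sub>R a \<in> even_supernumbers"
  and odd_add: "c \<in> odd_supernumbers \<Longrightarrow> d \<in> odd_supernumbers \<Longrightarrow> c + d \<in> odd_supernumbers"
  by (force simp: even_supernumbers_def odd_supernumbers_def coeff_one split: if_splits)+

lemma even_times: "a \<in> even_supernumbers \<Longrightarrow> b \<in> even_supernumbers \<Longrightarrow> a * b \<in> even_supernumbers"
  and even_times_odd: "a \<in> even_supernumbers \<Longrightarrow> c \<in> odd_supernumbers \<Longrightarrow> a * c \<in> odd_supernumbers"
  and odd_times_odd: "c \<in> odd_supernumbers \<Longrightarrow> d \<in> odd_supernumbers \<Longrightarrow> c * d \<in> even_supernumbers"
  by (auto simp: even_supernumbers_def odd_supernumbers_def elim!: coeff_times_nonzeroE)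

text \<open>With a type of their own, the even supernumbers satisfy the commutative ring laws
  without membership side conditions.\<close>

typedef even_supernumber = even_supernumbers
  morphisms of_even to_even
  using even_zero by blast

setup_lifting type_definition_even_supernumber

lemma even_supernumbers_eq_range: "even_supernumbers = range of_even"
  using type_definition.Rep_range[OF type_definition_even_supernumber] by simp

instantiation even_supernumber :: "{comm_ring_1, real_algebra_1}"
begin

lift_definition zero_even_supernumber :: even_supernumber is 0 by (rule even_zero)
lift_definition one_even_supernumber :: even_supernumber is 1 by (rule even_one)
lift_definition plus_even_supernumber :: "even_supernumber \<Rightarrow> even_supernumber \<Rightarrow> even_supernumber"
  is "(+)" by (rule even_add)
lift_definition minus_even_supernumber :: "even_supernumber \<Rightarrow> even_supernumber \<Rightarrow> even_supernumber"
  is "(-)" by (rule even_diff)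
lift_definition uminus_even_supernumber :: "even_supernumber \<Rightarrow> even_supernumber"
  is uminus by (rule even_uminus)
lift_definition times_even_supernumber :: "even_supernumber \<Rightarrow> even_supernumber \<Rightarrow> even_supernumber"
  is "(*)" by (rule even_times)
lift_definition scaleR_even_supernumber :: "real \<Rightarrow> even_supernumber \<Rightarrow> even_supernumber"
  is "(*\<^sub>R)" by (rule even_scaleR)

instance
  by standard
    (transfer; simp add: algebra_simps scaleR_add_left scaleR_add_right even_supernumber_central)+

end

lemma of_even_simps [simp]:
  "of_even 0 = 0" "of_even 1 = 1" "of_even (a + b) = of_even a + of_even b"
  "of_even (a - b) = of_even a - of_even b" "of_even (- a) = - of_even a"
  "of_even (a * b) = of_even a * of_even b" "of_even (r *\<^sub>R a) = r *\<^sub>R of_even a"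
  by (transfer; simp)+

lemma of_even_power [simp]: "of_even (a ^ n) = of_even a ^ n"
  by (induction n) auto

lemma of_even_sum: "of_even (sum f A) = (\<Sum>x\<in>A. of_even (f x))"
  by (induction A rule: infinite_finite_induct) auto

lemma of_even_eq_iff [simp]: "of_even a = of_even b \<longleftrightarrow> a = b"
  by (rule of_even_inject)

lemma of_even_eq_0_iff [simp]: "of_even a = 0 \<longleftrightarrow> a = 0"
  using of_even_inject[of a 0] by simp

lemma of_even_of_real [simp]: "of_even (of_real r) = of_real r"
  by (simp add: of_real_def)

section \<open>Body and soul of even supernumbers\<close>

lemma body_zero [simp]: "body 0 = 0" and body_one [simp]: "body 1 = 1"
  and body_add [simp]: "body (a + b) = body a + body b"
  and body_diff [simp]: "body (a - b) = body a - body b"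
  and body_uminus [simp]: "body (- a) = - body a"
  and body_scaleR [simp]: "body (r *\<^sub>R a) = r * body a"
  and body_times [simp]: "body (a * b) = body a * body b"
  by (simp_all add: body_def coeff_one coeff_times)

lemma body_odd: "c \<in> odd_supernumbers \<Longrightarrow> body c = 0"
  by (auto simp: body_def odd_supernumbers_def)

definition ebody :: "even_supernumber \<Rightarrow> real" where
  "ebody a = body (of_even a)"

lemma ebody_simps [simp]:
  "ebody 0 = 0" "ebody 1 = 1" "ebody (a + b) = ebody a + ebody b"
  "ebody (a - b) = ebody a - ebody b" "ebody (- a) = - ebody a"
  "ebody (a * b) = ebody a * ebody b" "ebody (r *\<^sub>R a) = r * ebody a"
  by (simp_all add: ebody_def)

lemma ebody_of_real [simp]: "ebody (of_real r) = r"
  by (simp add: of_real_def)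

lemma ebody_power [simp]: "ebody (a ^ n) = ebody a ^ n"
  by (induction n) auto

definition esoul :: "even_supernumber \<Rightarrow> even_supernumber" where
  "esoul a = a - of_real (ebody a)"

lemma of_even_esoul: "of_even (esoul a) = soul (of_even a)"
  by (simp add: esoul_def soul_def ebody_def)

lemma ebody_esoul [simp]: "ebody (esoul a) = 0"
  by (simp add: esoul_def)

lemma esoul_add: "esoul (a + b) = esoul a + esoul b" and esoul_uminus: "esoul (- a) = - esoul a"
  by (simp_all add: esoul_def)

lemma ebody_0_nilpotent:
  assumes "ebody a = 0"
  obtains N where "a ^ N = 0"
proof -
  have "esoul a = a" using assms by (simp add: esoul_def)
  moreover obtain N where "soul (of_even a) ^ N = 0" using soul_nilpotent by blast
  ultimately have "of_even (a ^ N) = 0" by (simp flip: of_even_esoul)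
  then show ?thesis using that of_even_eq_0_iff by blast
qed

section \<open>The exponential function\<close>

text \<open>The exponential series of a nilpotent element, restricted to its nonzero terms. If
  \<open>a\<close> is not nilpotent, the index set is infinite and the value is the default
  \<open>0\<close>.\<close>

definition nexp :: "even_supernumber \<Rightarrow> even_supernumber" where
  "nexp a = (\<Sum>k | a ^ k \<noteq> 0. a ^ k /\<^sub>R fact k)"

lemma power_eq_0_mono:
  fixes a :: "'a :: semiring_1"
  shows "a ^ N = 0 \<Longrightarrow> N \<le> k \<Longrightarrow> a ^ k = 0"
  by (metis le_add_diff_inverse mult_zero_left power_add)

lemma nexp_eq:
  assumes "a ^ N = 0"
  shows "nexp a = (\<Sum>k<N. a ^ k /\<^sub>R fact k)"
  unfolding nexp_def
  by (rule sum.mono_neutral_left) (use power_eq_0_mono[OF assms] in \<open>auto simp: not_le[symmetric]\<close>)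

text \<open>The binomial theorem turns the series of the sum into a Cauchy product; nilpotency makes
  all sums finite.\<close>

lemma nexp_add:
  assumes "ebody a = 0" "ebody b = 0"
  shows "nexp (a + b) = nexp a * nexp b"
proof -
  obtain M N where "a ^ M = 0" "b ^ N = 0" using assms by (elim ebody_0_nilpotent)
  define K where "K = max M N"
  have K: "a ^ k = 0" "b ^ k = 0" if "K \<le> k" for k
    using that \<open>a ^ M = 0\<close> \<open>b ^ N = 0\<close> power_eq_0_mono unfolding K_def by (metis max.bounded_iff)+
  let ?t = "\<lambda>(i, j). (a ^ i /\<^sub>R fact i) * (b ^ j /\<^sub>R fact j)"
  have binom: "(a + b) ^ n /\<^sub>R fact n = (\<Sum>i\<le>n. ?t (i, n - i))" for n
    unfolding binomial_ring scaleR_sum_right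
  proof (rule sum.cong[OF refl])
    fix i assume "i \<in> {..n}"
    then have "real (n choose i) / fact n = 1 / (fact i * fact (n - i))"
      by (simp add: binomial_fact)
    moreover have "(of_nat (n choose i) * a ^ i * b ^ (n - i)) /\<^sub>R fact n =
        (real (n choose i) / fact n) *\<^sub>R (a ^ i * b ^ (n - i))"
      by (simp add: scaleR_conv_of_real mult_ac divide_inverse)
    ultimately show "(of_nat (n choose i) * a ^ i * b ^ (n - i)) /\<^sub>R fact n = ?t (i, n - i)"
      by (simp add: divide_inverse mult.commute)
  qed
  have zero: "(a ^ i /\<^sub>R fact i) * (b ^ j /\<^sub>R fact j) = 0" if "K + K \<le> i + j" for i j
    using that K(1)[of i] K(2)[of j] by (cases "K \<le> i") auto
  \<comment> \<open>The binomial expansion itself shows that \<open>K + K\<close> bounds the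
    nilpotency order of the sum, so \<open>K + K\<close> terms suffice for
    \<open>nexp (a + b)\<close>.\<close>
  have "(a + b) ^ (K + K) /\<^sub>R fact (K + K) = 0"
    unfolding binom by (rule sum.neutral) (use zero in auto)
  then have "(a + b) ^ (K + K) = 0" by simp
  then have "nexp (a + b) = (\<Sum>n<K + K. \<Sum>i\<le>n. ?t (i, n - i))"
    by (simp add: nexp_eq binom)
  also have "\<dots> = sum ?t {(i, j). i + j < K + K}"
    unfolding sum.triangle_reindex by simp
  \<comment> \<open>Outside the triangle, one of the two exponents is at least \<open>K\<close>, so
    enlarging it to the square adds only zeros.\<close>
  also have "\<dots> = sum ?t ({..<K + K} \<times> {..<K + K})"
    by (rule sum.mono_neutral_left) (use zero in \<open>auto simp flip: not_le\<close>)
  also have "\<dots> = (\<Sum>i<K + K. a ^ i /\<^sub>R fact i) * (\<Sum>j<K + K. b ^ j /\<^sub>R fact j)"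
    by (simp add: sum_product sum.cartesian_product)
  also have "\<dots> = nexp a * nexp b"
    using K by (simp add: nexp_eq[of a "K + K"] nexp_eq[of b "K + K"])
  finally show ?thesis .
qed

text \<open>Body and soul are exponentiated separately, because only the nilpotent soul has a finite
  series.\<close>

definition eexp :: "even_supernumber \<Rightarrow> even_supernumber" where
  "eexp a = exp (ebody a) *\<^sub>R nexp (esoul a)"

lemma eexp_add: "eexp (a + b) = eexp a * eexp b"
  by (simp add: eexp_def esoul_add nexp_add exp_add)

lemma nexp_0 [simp]: "nexp 0 = 1"
  using nexp_eq[of 0 1] by simp

lemma eexp_0 [simp]: "eexp 0 = 1"
  by (simp add: eexp_def esoul_def)

lemma eexp_minus: "eexp a * eexp (- a) = 1"
  using eexp_add[of a "- a"] by simp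

lemma nexp_expansion:
  assumes "ebody a = 0"
  obtains b where "nexp a = 1 + a + a\<^sup>2 * b"
proof -
  obtain N where "a ^ N = 0" using assms by (rule ebody_0_nilpotent)
  \<comment> \<open>The bound is raised by two so that the two leading terms can be split
    off.\<close>
  then have "a ^ Suc (Suc N) = 0" by simp
  then have "nexp a = (\<Sum>k<Suc (Suc N). a ^ k /\<^sub>R fact k)" by (rule nexp_eq)
  also have "\<dots> = 1 + a + (\<Sum>k<N. a ^ (2 + k) /\<^sub>R fact (2 + k))"
    by (simp only: sum.lessThan_Suc_shift) (simp add: add.assoc)
  also have "\<dots> = 1 + a + a\<^sup>2 * (\<Sum>k<N. a ^ k /\<^sub>R fact (2 + k))"
    by (simp only: power_add sum_distrib_left mult_scaleR_right)
  finally show ?thesis by (rule that)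
qed

lemma ebody_nexp:
  assumes "ebody a = 0" shows "ebody (nexp a) = 1"
  using nexp_expansion[OF assms] assms by (metis add.right_neutral ebody_simps(2,3,6) ebody_power mult_zero_left zero_power2)

lemma ebody_eexp [simp]: "ebody (eexp a) = exp (ebody a)"
  by (simp add: eexp_def ebody_nexp)

text \<open>
  Multiplying \<open>1 + a\<close> by \<open>nexp (- a)\<close> leaves \<open>1\<close> plus a multiple of \<open>a\<^sup>2\<close>, which halves the order
  of nilpotency.
\<close>

lemma nexp_surj:
  assumes "a ^ N = 0" "ebody a = 0"
  shows "\<exists>b. ebody b = 0 \<and> nexp b = 1 + a"
  using assms
proof (induction N arbitrary: a rule: less_induct)
  case (less N)
  show ?case
  proof (cases "N \<le> 1")
    case True
    then have "a = 0" using less.prems power_eq_0_mono[of a N 1] by simp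
    then show ?thesis by (intro exI[of _ 0]) simp
  next
    case False
    obtain c where c: "nexp (- a) = 1 + (- a) + (- a)\<^sup>2 * c"
      using nexp_expansion[of "- a"] less.prems by auto
    define a' where "a' = a\<^sup>2 * (- 1 + c + a * c)"
    have a': "nexp (- a) * (1 + a) = 1 + a'"
      unfolding c a'_def by (simp add: algebra_simps power2_eq_square)
    \<comment> \<open>\<open>N - N div 2\<close> is half of \<open>N\<close> rounded up, so its
      double is at least \<open>N\<close>.\<close>
    have "a ^ (2 * (N - N div 2)) = 0"
      by (rule power_eq_0_mono[OF less.prems(1)]) simp
    then have "a' ^ (N - N div 2) = 0"
      by (simp add: a'_def power_mult_distrib flip: power_mult)
    moreover have "N - N div 2 < N" using False by simp
    moreover have "ebody a' = 0" using less.prems by (simp add: a'_def)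
    ultimately obtain b where b: "ebody b = 0" "nexp b = 1 + a'" using less.IH by blast
    \<comment> \<open>Adding \<open>a\<close> to the logarithm \<open>b\<close> of
      \<open>nexp (- a) * (1 + a)\<close> undoes the multiplication by
      \<open>nexp (- a)\<close>.\<close>
    have "nexp (a + b) = nexp (a + - a) * (1 + a)"
      using less.prems b a' by (simp only: nexp_add ebody_simps) (simp add: mult.assoc)
    then show ?thesis using b less.prems by (intro exI[of _ "a + b"]) simp
  qed
qed

text \<open>Dividing by the body leaves \<open>1\<close> plus a nilpotent element, whose logarithm
  comes from \<open>nexp_surj\<close>; the real logarithm of the body is then added.\<close>

lemma eexp_surj:
  assumes "ebody a > 0"
  obtains b where "eexp b = a"
proof -
  define n where "n = a /\<^sub>R ebody a - 1"
  have "ebody n = 0" using assms by (simp add: n_def)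
  then obtain b where b: "ebody b = 0" "nexp b = 1 + n"
    using nexp_surj ebody_0_nilpotent by metis
  have "eexp (of_real (ln (ebody a)) + b) = ebody a *\<^sub>R (1 + n)"
    using b assms by (simp add: eexp_def esoul_def)
  also have "\<dots> = a" using assms by (simp add: n_def)
  finally show ?thesis by (rule that)
qed

text \<open>Up to sign the element is an exponential, and \<open>eexp (- b)\<close> inverts
  \<open>eexp b\<close>.\<close>

lemma ebody_nonzero_inverse:
  assumes "ebody a \<noteq> 0"
  obtains b where "a * b = 1"
proof (cases "ebody a > 0")
  case True
  then show ?thesis using eexp_surj eexp_minus that by metis
next
  case False
  then have "ebody (- a) > 0" using assms by simp
  then obtain b where "eexp b = - a" by (rule eexp_surj)
  then have "a * - eexp (- b) = 1" using eexp_minus[of b] by simp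
  then show ?thesis by (rule that)
qed

lemma mult_eq_0_even:
  assumes "ebody a \<noteq> 0" "a * b = 0"
  shows "b = 0"
proof -
  obtain c where "a * c = 1" using assms(1) by (rule ebody_nonzero_inverse)
  then have "b = b * (a * c)" by simp
  also have "\<dots> = (a * b) * c" by (simp only: mult_ac)
  finally have "b = (a * b) * c" .
  then show ?thesis using assms by simp
qed

text \<open>The ring has zero divisors, but the bodies of \<open>a + b\<close> and
  \<open>a - b\<close> differ by \<open>2 * ebody b\<close>, so at least one of these factors is
  invertible.\<close>

lemma square_eq_square_cases:
  fixes a b :: even_supernumber
  assumes "a\<^sup>2 = b\<^sup>2" "ebody b \<noteq> 0"
  shows "a = b \<or> a = - b"
proof -
  have prod: "(a - b) * (a + b) = 0"
    using assms by (simp add: algebra_simps power2_eq_square)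
  show ?thesis
  proof (cases "ebody (a - b) = 0")
    case True
    then have "ebody (a + b) \<noteq> 0" using assms(2) by simp
    then show ?thesis using mult_eq_0_even prod by (metis eq_iff_diff_eq_0 mult.commute)
  next
    case False
    then show ?thesis using mult_eq_0_even prod by (metis add_eq_0_iff2)
  qed
qed

lemma pos_square_inj:
  assumes "a\<^sup>2 = b\<^sup>2" "ebody a > 0" "ebody b > 0"
  shows "a = b"
  using square_eq_square_cases[OF assms(1)] assms(2,3) by auto

section \<open>Taylor extensions of cosh and sinh\<close>

lemma super_ext_eq:
  assumes "soul a ^ N = 0"
  shows "super_ext f a = (\<Sum>n<N. ((deriv ^^ n) f (body a) / fact n) *\<^sub>R soul a ^ n)"
  unfolding super_ext_def
  by (rule sum.mono_neutral_left) (use power_eq_0_mono[OF assms] in \<open>auto simp: not_le[symmetric]\<close>)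

text \<open>The values \<open>c = 1\<close> and \<open>c = -1\<close> give cosh and sinh, so both
  are treated at once.\<close>

lemma deriv_exp_combination:
  "(deriv ^^ n) (\<lambda>x. (exp x + c * exp (- x)) / 2) = (\<lambda>x :: real. (exp x + (-1) ^ n * c * exp (- x)) / 2)"
proof (induction n)
  case (Suc n)
  have "deriv (\<lambda>x :: real. (exp x + (-1) ^ n * c * exp (- x)) / 2) x
      = (exp x + (-1) ^ Suc n * c * exp (- x)) / 2" for x
    by (rule DERIV_imp_deriv) (auto intro!: derivative_eq_intros)
  then show ?case using Suc by auto
qed simp

text \<open>The sign \<open>(-1) ^ n\<close> of the n-th derivative is absorbed into the n-th power
  of the negated soul, which yields the series of \<open>eexp (- a)\<close>.\<close>

lemma super_ext_exp_combination:
  "super_ext (\<lambda>x. (exp x + c * exp (- x)) / 2) (of_even a) =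
    of_even ((1 / 2) *\<^sub>R (eexp a + c *\<^sub>R eexp (- a)))"
proof -
  obtain N where N: "esoul a ^ N = 0" using ebody_0_nilpotent[OF ebody_esoul] .
  then have N': "soul (of_even a) ^ N = 0"
    by (metis of_even_esoul of_even_power of_even_simps(1))
  have minus: "(- soul (of_even a)) ^ n = (-1) ^ n *\<^sub>R soul (of_even a) ^ n" for n
    using power_minus[of "soul (of_even a)" n] by (simp add: scaleR_conv_of_real)
  have "of_even (eexp a) = (\<Sum>n<N. (exp (ebody a) / fact n) *\<^sub>R soul (of_even a) ^ n)"
    by (simp add: eexp_def nexp_eq[OF N] of_even_sum scaleR_sum_right of_even_esoul divide_inverse)
  moreover have "(- esoul a) ^ N = 0" using N by (simp add: power_minus[of "esoul a"])
  then have "of_even (eexp (- a)) =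
      (\<Sum>n<N. ((-1) ^ n * exp (- ebody a) / fact n) *\<^sub>R soul (of_even a) ^ n)"
    by (simp add: eexp_def esoul_uminus nexp_eq of_even_sum scaleR_sum_right of_even_esoul
        divide_inverse minus mult_ac)
  ultimately have "of_even ((1 / 2) *\<^sub>R (eexp a + c *\<^sub>R eexp (- a))) =
      (\<Sum>n<N. (1 / 2) *\<^sub>R ((exp (ebody a) / fact n) *\<^sub>R soul (of_even a) ^ n
        + c *\<^sub>R ((-1) ^ n * exp (- ebody a) / fact n) *\<^sub>R soul (of_even a) ^ n))"
    by (simp only: of_even_simps scaleR_sum_right sum.distrib scaleR_right_distrib)
  also have "\<dots> = (\<Sum>n<N. ((exp (ebody a) + (-1) ^ n * c * exp (- ebody a)) / 2 / fact n)
      *\<^sub>R soul (of_even a) ^ n)"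
    by (rule sum.cong[OF refl], simp only: scaleR_scaleR flip: scaleR_left_distrib)
      (simp add: field_simps)
  finally show ?thesis
    by (simp only: super_ext_eq[OF N'] deriv_exp_combination ebody_def)
qed

lemma super_ext_cosh: "super_ext cosh (of_even a) = of_even ((1 / 2) *\<^sub>R (eexp a + eexp (- a)))"
proof -
  have "cosh = (\<lambda>x :: real. (exp x + 1 * exp (- x)) / 2)" by (simp add: cosh_field_def fun_eq_iff)
  then show ?thesis using super_ext_exp_combination[of 1 a] by simp
qed

lemma super_ext_sinh: "super_ext sinh (of_even a) = of_even ((1 / 2) *\<^sub>R (eexp a - eexp (- a)))"
proof -
  have "sinh = (\<lambda>x :: real. (exp x + (-1) * exp (- x)) / 2)" by (simp add: sinh_field_def fun_eq_iff)
  then show ?thesis using super_ext_exp_combination[of "-1" a] by simp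
qed

section \<open>Frames and supergeodesics\<close>

definition ecosh :: "even_supernumber \<Rightarrow> even_supernumber" where
  "ecosh a = (1 / 2) *\<^sub>R (eexp a + eexp (- a))"

definition esinh :: "even_supernumber \<Rightarrow> even_supernumber" where
  "esinh a = (1 / 2) *\<^sub>R (eexp a - eexp (- a))"

lemma ecosh_plus_esinh: "ecosh a + esinh a = eexp a"
  and ecosh_minus_esinh: "ecosh a - esinh a = eexp (- a)"
  by (simp_all add: ecosh_def esinh_def algebra_simps flip: scaleR_left_distrib)

text \<open>The pairs \<open>(ecosh s, esinh s)\<close> described without a parameter. In the
  factored form, \<open>c + d\<close> and \<open>c - d\<close> stand for the exponentials of
  \<open>s\<close> and \<open>- s\<close>.\<close>

definition hyperbola :: "even_supernumber \<Rightarrow> even_supernumber \<Rightarrow> bool" where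
  "hyperbola c d \<longleftrightarrow> (c + d) * (c - d) = 1 \<and> ebody c > 0"

lemma hyperbolaD:
  assumes "hyperbola c d"
  shows "c * c - d * d = 1" "ebody c * ebody c - ebody d * ebody d = 1"
    "ebody (c + d) > 0" "ebody (c - d) > 0"
proof -
  show *: "c * c - d * d = 1" using assms by (simp add: hyperbola_def algebra_simps)
  then show "ebody c * ebody c - ebody d * ebody d = 1" by (metis ebody_simps(2,4,6))
  then have "\<bar>ebody d\<bar> < \<bar>ebody c\<bar>"
    by (metis abs_le_square_iff diff_le_0_iff_le not_le power2_eq_square zero_less_one)
  then show "ebody (c + d) > 0" "ebody (c - d) > 0"
    using assms by (auto simp: hyperbola_def)
qed

lemma hyperbola_ecosh_esinh: "hyperbola (ecosh s) (esinh s)"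
  unfolding hyperbola_def ecosh_plus_esinh ecosh_minus_esinh
  by (simp add: eexp_minus ecosh_def add_pos_pos)

lemma add_diff_eqD:
  fixes c d c' d' :: even_supernumber
  assumes "c + d = c' + d'" "c - d = c' - d'"
  shows "c = c'" "d = d'"
proof -
  have "2 *\<^sub>R c = (c + d) + (c - d)" "2 *\<^sub>R c' = (c' + d') + (c' - d')"
    by (simp_all add: scaleR_2)
  then have "2 *\<^sub>R c = 2 *\<^sub>R c'" using assms by simp
  then show "c = c'" by simp
  then show "d = d'" using assms by simp
qed

text \<open>On the hyperbola \<open>c - d\<close> is the inverse of \<open>c + d\<close>, so the sum
  fixes the difference.\<close>

lemma hyperbola_eqI:
  assumes "hyperbola c d" "hyperbola c' d'" "c + d = c' + d'"
  shows "c = c'" "d = d'"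
proof -
  have "c - d = (c - d) * ((c' + d') * (c' - d'))" using assms by (simp add: hyperbola_def)
  also have "\<dots> = ((c + d) * (c - d)) * (c' - d')" using assms by (simp add: mult_ac)
  also have "\<dots> = c' - d'" using assms by (simp add: hyperbola_def)
  finally show "c = c'" "d = d'" using assms(3) add_diff_eqD by blast+
qed

text \<open>The parameter is the logarithm of \<open>c + d\<close>, whose body is positive.\<close>

lemma hyperbola_imp_ecosh_esinh:
  assumes "hyperbola c d"
  obtains s where "c = ecosh s" "d = esinh s"
proof -
  obtain s where "eexp s = c + d" using hyperbolaD(3)[OF assms] by (rule eexp_surj)
  then show ?thesis
    using that hyperbola_eqI[OF assms hyperbola_ecosh_esinh] ecosh_plus_esinh by metis
qed

section \<open>Even multiples and the pairing\<close>

definition emult :: "even_supernumber \<Rightarrow> superpoint \<Rightarrow> superpoint"  (infixr \<open>\<odot>\<close> 75) where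
  "c \<odot> x = smult (of_even c) x"

lemma emult_simps [simp]:
  "1 \<odot> x = x" "0 \<odot> x = 0" "(- a) \<odot> x = - (a \<odot> x)" "a \<odot> (- x) = - (a \<odot> x)"
  by (cases x rule: prod_cases5; simp add: emult_def zero_prod_def)+

lemma emult_add:
  "a \<odot> (x + y) = a \<odot> x + a \<odot> y" "(a + b) \<odot> x = a \<odot> x + b \<odot> x"
  by (cases x rule: prod_cases5; cases y rule: prod_cases5; simp add: emult_def algebra_simps)+

lemma emult_diff: "a \<odot> (x - y) = a \<odot> x - a \<odot> y" "(a - b) \<odot> x = a \<odot> x - b \<odot> x"
  using emult_add(1)[of a x "- y"] emult_add(2)[of a "- b" x] by simp_all

lemma emult_emult: "a \<odot> (b \<odot> x) = (a * b) \<odot> x"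
  by (cases x rule: prod_cases5) (simp add: emult_def mult.assoc)

lemma emult_cancel:
  assumes "ebody a \<noteq> 0" "a \<odot> x = a \<odot> y"
  shows "x = y"
proof -
  obtain b where "a * b = 1" using assms(1) by (rule ebody_nonzero_inverse)
  then have "b * a = 1" by (simp add: mult.commute)
  then show ?thesis using assms(2) by (metis emult_emult emult_simps(1))
qed

lemma of_even_commute: "a * of_even c = of_even c * a"
  by (rule even_supernumber_central[OF of_even, symmetric])

lemma pairing_add:
  "pairing (x + y) z = pairing x z + pairing y z" "pairing z (x + y) = pairing z x + pairing z y"
  by (cases x rule: prod_cases5; cases y rule: prod_cases5; cases z rule: prod_cases5;
      simp add: algebra_simps)+

lemma pairing_emult:
  "pairing (c \<odot> x) y = of_even c * pairing x y" "pairing x (c \<odot> y) = of_even c * pairing x y"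
proof -
  have *: "z * (of_even c * w) = of_even c * (z * w)" for z w
    by (metis mult.assoc of_even_commute)
  show "pairing (c \<odot> x) y = of_even c * pairing x y" "pairing x (c \<odot> y) = of_even c * pairing x y"
    by (cases x rule: prod_cases5; cases y rule: prod_cases5;
        simp add: emult_def * mult.assoc distrib_left right_diff_distrib)+
qed

lemma pairing_uminus: "pairing (- x) y = - pairing x y" "pairing x (- y) = - pairing x y"
  using pairing_emult[where c = "- 1"] by simp_all

lemma pairing_diff:
  "pairing (x - y) z = pairing x z - pairing y z" "pairing z (x - y) = pairing z x - pairing z y"
  using pairing_add(1)[of x "- y" z] pairing_add(2)[of z x "- y"] by (simp_all add: pairing_uminus)

lemmas pairing_linear = pairing_add pairing_diff pairing_emult pairing_uminus

lemma minkowski_closed [simp]: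
  "x \<in> minkowski \<Longrightarrow> y \<in> minkowski \<Longrightarrow> x + y \<in> minkowski"
  "x \<in> minkowski \<Longrightarrow> c \<odot> x \<in> minkowski"
  by (cases x rule: prod_cases5; cases y rule: prod_cases5;
      use of_even[of c] in \<open>simp add: minkowski_def emult_def even_add odd_add even_times even_times_odd\<close>)+

lemma minkowski_uminus [simp]: "x \<in> minkowski \<Longrightarrow> - x \<in> minkowski"
  using minkowski_closed(2)[of x "- 1"] by simp

lemma minkowski_diff [simp]: "x \<in> minkowski \<Longrightarrow> y \<in> minkowski \<Longrightarrow> x - y \<in> minkowski"
  using minkowski_closed(1)[of x "- y"] by simp

lemma pairing_commute: "x \<in> minkowski \<Longrightarrow> y \<in> minkowski \<Longrightarrow> pairing x y = pairing y x"
  by (cases x rule: prod_cases5; cases y rule: prod_cases5)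
    (auto simp: minkowski_def even_supernumber_central add_ac)

lemma pairing_evenE:
  assumes "x \<in> minkowski" "y \<in> minkowski"
  obtains c where "pairing x y = of_even c"
proof -
  have "pairing x y \<in> even_supernumbers"
    using assms
    by (cases x rule: prod_cases5; cases y rule: prod_cases5)
      (simp add: minkowski_def even_add even_diff even_scaleR even_times odd_times_odd)
  then show ?thesis using that of_even_cases by metis
qed

section \<open>Bodies in real Minkowski space\<close>

fun real_pairing :: "real \<times> real \<times> real \<Rightarrow> real \<times> real \<times> real \<Rightarrow> real" where
  "real_pairing (a1, a2, a3) (b1, b2, b3) = (a1 * b2 + b1 * a2) / 2 - a3 * b3"

fun height :: "real \<times> real \<times> real \<Rightarrow> real" where
  "height (a1, a2, a3) = a1 + a2"

lemma body_point_linear: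
  "body_point (x + y) = body_point x + body_point y"
  "body_point (x - y) = body_point x - body_point y"
  "body_point (- x) = - body_point x"
  "body_point (c \<odot> x) = ebody c *\<^sub>R body_point x"
  by (cases x rule: prod_cases5; cases y rule: prod_cases5; simp add: emult_def ebody_def)+

lemma body_pairing:
  "x \<in> minkowski \<Longrightarrow> y \<in> minkowski \<Longrightarrow>
    body (pairing x y) = real_pairing (body_point x) (body_point y)"
  by (cases x rule: prod_cases5; cases y rule: prod_cases5) (auto simp: minkowski_def body_odd)

lemma height_body_point:
  "(case x of (x1, x2, _) \<Rightarrow> body (x1 + x2) > 0) \<longleftrightarrow> height (body_point x) > 0"
  by (cases x rule: prod_cases5) simp

lemma super_H_iff:
  "x \<in> super_H \<longleftrightarrow> x \<in> minkowski \<and> pairing x x = 1 \<and> height (body_point x) > 0"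
  and light_cone_iff:
  "x \<in> light_cone \<longleftrightarrow> x \<in> minkowski \<and> pairing x x = 0 \<and> height (body_point x) > 0"
  by (simp_all only: super_H_def light_cone_def height_body_point mem_Collect_eq)

lemma frame_iff:
  "frame u v \<longleftrightarrow> u \<in> minkowski \<and> v \<in> minkowski \<and> pairing u u = 1 \<and> pairing v v = - 1 \<and>
    pairing u v = 0 \<and> pairing v u = 0 \<and> height (body_point u) > 0"
  unfolding frame_def super_H_iff super_D_def using pairing_commute[of u v] by auto

lemma height_linear:
  "height (a + b) = height a + height b" "height (a - b) = height a - height b"
  "height (r *\<^sub>R a) = r * height a"
  by (cases a; cases b; simp add: algebra_simps)+

text \<open>A null vector that does not point to the future has nonpositive coordinates
  \<open>n1\<close> and \<open>n2\<close>; by a reversed Cauchy-Schwarz estimate it then pairs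
  nonpositively with the future unit vector \<open>u\<close>.\<close>

lemma null_height_pos:
  assumes n: "real_pairing n n = 0" "real_pairing n u > 0"
    and u: "real_pairing u u = 1" "height u > 0"
  shows "height n > 0"
proof -
  obtain n1 n2 n3 u1 u2 u3 where [simp]: "n = (n1, n2, n3)" "u = (u1, u2, u3)" by (metis prod_cases3)
  have nn: "n1 * n2 = n3 * n3" and uu: "u1 * u2 = 1 + u3 * u3" using n u by auto
  have "u1 * u2 > 0" unfolding uu by (simp add: add_pos_nonneg)
  then have u_pos: "u1 > 0" "u2 > 0" using u(2) by (auto simp: zero_less_mult_iff)
  show ?thesis
  proof (rule ccontr)
    assume "\<not> height n > 0"
    then have sum: "n1 + n2 \<le> 0" by simp
    have "n1 * n2 \<ge> 0" unfolding nn by simp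
    then have "n1 \<le> 0" "n2 \<le> 0" using sum by (auto simp: zero_le_mult_iff)
    then have neg: "n1 * u2 + u1 * n2 \<le> 0" using u_pos by (simp add: add_nonpos_nonpos mult_nonneg_nonpos mult_nonpos_nonneg)
    \<comment> \<open>This is the inequality between geometric and arithmetic mean for
      \<open>n1 * u2\<close> and \<open>u1 * n2\<close>.\<close>
    have "(2 * (n3 * u3))\<^sup>2 = 4 * (n1 * n2) * (u3 * u3)" unfolding nn by (simp add: power2_eq_square)
    also have "\<dots> \<le> 4 * (n1 * n2) * (u1 * u2)"
      unfolding uu using \<open>n1 * n2 \<ge> 0\<close> by (intro mult_left_mono) auto
    also have "\<dots> = (n1 * u2 + u1 * n2)\<^sup>2 - (n1 * u2 - u1 * n2)\<^sup>2"
      by (simp add: power2_eq_square algebra_simps)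
    also have "\<dots> \<le> (n1 * u2 + u1 * n2)\<^sup>2" by simp
    finally have "\<bar>2 * (n3 * u3)\<bar> \<le> \<bar>n1 * u2 + u1 * n2\<bar>" by (simp only: abs_le_square_iff)
    then show False using neg n(2) by simp
  qed
qed

text \<open>This is the equality case of the reversed Cauchy-Schwarz inequality: it forces
  \<open>a1 * b2 = b1 * a2\<close>, so the first two coordinates are proportional, and the null
  condition fixes the third up to sign.\<close>

lemma null_pairing_pos:
  assumes a: "real_pairing a a = 0" "height a > 0" and b: "real_pairing b b = 0" "height b > 0"
    and npos: "real_pairing a b \<le> 0"
  obtains r where "r > 0" "b = r *\<^sub>R a"
proof -
  obtain a1 a2 a3 b1 b2 b3 where [simp]: "a = (a1, a2, a3)" "b = (b1, b2, b3)" by (metis prod_cases3)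
  have aa: "a1 * a2 = a3 * a3" and bb: "b1 * b2 = b3 * b3" using a b by auto
  have "a1 * a2 \<ge> 0" "b1 * b2 \<ge> 0" unfolding aa bb by simp_all
  then have nonneg: "a1 \<ge> 0" "a2 \<ge> 0" "b1 \<ge> 0" "b2 \<ge> 0"
    using a(2) b(2) by (auto simp: zero_le_mult_iff)
  define S where "S = a1 * b2 + b1 * a2"
  have S: "0 \<le> S" "S \<le> 2 * (a3 * b3)" using nonneg npos by (auto simp: S_def)
  have "S\<^sup>2 - (a1 * b2 - b1 * a2)\<^sup>2 = 4 * (a1 * a2) * (b1 * b2)"
    by (simp add: S_def power2_eq_square algebra_simps)
  also have "\<dots> = (2 * (a3 * b3))\<^sup>2" unfolding aa bb by (simp add: power2_eq_square)
  also have "\<dots> \<ge> S\<^sup>2" using S by (intro power_mono) auto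
  finally have eq: "a1 * b2 = b1 * a2" by simp
  define r where "r = (b1 + b2) / (a1 + a2)"
  have sum: "a1 + a2 > 0" "b1 + b2 > 0" using a b by auto
  have e: "b1 * (a1 + a2) = a1 * (b1 + b2)" "b2 * (a1 + a2) = a2 * (b1 + b2)"
    using eq by (simp_all add: algebra_simps)
  then have r12: "b1 = r * a1" "b2 = r * a2" using sum by (simp_all add: r_def field_simps)
  have "r > 0" using sum by (simp add: r_def)
  have "b3 * b3 = r * r * (a1 * a2)" unfolding bb[symmetric] r12 by simp
  then have "b3\<^sup>2 = (r * a3)\<^sup>2" unfolding aa by (simp add: power2_eq_square)
  then have "b3 = r * a3 \<or> b3 = - (r * a3)" by (simp add: power2_eq_iff)
  \<comment> \<open>The wrong sign would make \<open>a3 * b3\<close> nonpositive, while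
    \<open>S\<close> shows that it is nonnegative; so both third coordinates vanish.\<close>
  moreover have "b3 = r * a3" if "b3 = - (r * a3)"
  proof -
    have "a3 * b3 = - (r * (a3 * a3))" by (simp add: that)
    then have "r * (a3 * a3) \<le> 0" using S by linarith
    then have "a3 = 0" using \<open>r > 0\<close> by (auto simp: mult_le_0_iff)
    then show ?thesis using that by simp
  qed
  ultimately show ?thesis using that[OF \<open>r > 0\<close>] r12 by auto
qed

text \<open>The squared gap in the reversed Cauchy-Schwarz inequality is a sum of squares, which
  vanishes only if \<open>a3 = b3\<close> and \<open>a1 * b2 = b1 * a2\<close>; for future unit
  vectors this means \<open>a = b\<close>.\<close>

lemma unit_pairing_gt_1:
  assumes a: "real_pairing a a = 1" "height a > 0" and b: "real_pairing b b = 1" "height b > 0"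
    and ne: "a \<noteq> b"
  shows "real_pairing a b > 1"
proof (rule ccontr)
  assume le: "\<not> real_pairing a b > 1"
  obtain a1 a2 a3 b1 b2 b3 where [simp]: "a = (a1, a2, a3)" "b = (b1, b2, b3)" by (metis prod_cases3)
  have aa: "a1 * a2 = 1 + a3 * a3" and bb: "b1 * b2 = 1 + b3 * b3" using a b by auto
  have "a1 * a2 > 0" "b1 * b2 > 0" unfolding aa bb by (simp_all add: add_pos_nonneg)
  then have pos: "a1 > 0" "a2 > 0" "b1 > 0" "b2 > 0"
    using a(2) b(2) by (auto simp: zero_less_mult_iff)
  define S where "S = a1 * b2 + b1 * a2"
  have S: "0 \<le> S" "S \<le> 2 * (1 + a3 * b3)" using pos le by (auto simp: S_def field_simps)
  have "S\<^sup>2 - (a1 * b2 - b1 * a2)\<^sup>2 = 4 * (a1 * a2) * (b1 * b2)"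
    by (simp add: S_def power2_eq_square algebra_simps)
  also have "\<dots> = (2 * (1 + a3 * b3))\<^sup>2 + 4 * (a3 - b3)\<^sup>2"
    unfolding aa bb by (simp add: power2_eq_square algebra_simps)
  finally have "S\<^sup>2 = (2 * (1 + a3 * b3))\<^sup>2 + 4 * (a3 - b3)\<^sup>2 + (a1 * b2 - b1 * a2)\<^sup>2" by simp
  moreover have "S\<^sup>2 \<le> (2 * (1 + a3 * b3))\<^sup>2" using S by (intro power_mono) auto
  ultimately have "4 * (a3 - b3)\<^sup>2 + (a1 * b2 - b1 * a2)\<^sup>2 \<le> 0" by simp
  then have "a3 = b3" and e: "a1 * b2 = b1 * a2"
    using zero_le_power2[of "a3 - b3"] zero_le_power2[of "a1 * b2 - b1 * a2"]
    by (smt (verit) zero_eq_power2)+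
  then have "a1 * a2 = b1 * b2" using aa bb by simp
  then have "a1 * a1 * (a2 * b2) = b1 * b1 * (a2 * b2)" using e by (metis mult.commute mult.left_commute)
  then have "a1\<^sup>2 = b1\<^sup>2" using pos by (simp add: power2_eq_square)
  then have "a1 = b1" using pos by (simp add: power2_eq_iff_nonneg)
  then have "a2 = b2" using e pos by simp
  then show False using ne \<open>a1 = b1\<close> \<open>a3 = b3\<close> by simp
qed

text \<open>Both vectors are null and have pairing \<open>1\<close> with \<open>u\<close>, so
  \<open>null_height_pos\<close> applies to their bodies.\<close>

lemma frame_light_cone:
  assumes "frame u v"
  shows "u + v \<in> light_cone" "u - v \<in> light_cone"
proof -
  note f = assms[unfolded frame_iff]
  have 1: "pairing (u + v) (u + v) = 0" "pairing (u - v) (u - v) = 0"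
    and "pairing (u + v) u = 1" "pairing (u - v) u = 1"
    using f by (simp_all add: pairing_linear)
  then have "height (body_point (u + v)) > 0" "height (body_point (u - v)) > 0"
    using f by (auto intro!: null_height_pos[of _ "body_point u"] simp flip: body_pairing)
  then show "u + v \<in> light_cone" "u - v \<in> light_cone"
    using 1 f by (simp_all add: light_cone_iff)
qed

section \<open>Change of base point and orientation\<close>

lemma supergeodesic_of_eq:
  "supergeodesic_of u v = {c \<odot> u + d \<odot> v | c d. hyperbola c d}"
proof -
  have "geo_point u v (of_even s) = ecosh s \<odot> u + esinh s \<odot> v" for s
    by (simp add: geo_point_def super_ext_cosh super_ext_sinh emult_def ecosh_def esinh_def)
  moreover have "supergeodesic_of u v = range (\<lambda>s. geo_point u v (of_even s))"
    unfolding supergeodesic_of_def even_supernumbers_eq_range by blast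
  ultimately have eq: "supergeodesic_of u v = range (\<lambda>s. ecosh s \<odot> u + esinh s \<odot> v)" by simp
  show ?thesis
  proof (rule subset_antisym)
    show "supergeodesic_of u v \<subseteq> {c \<odot> u + d \<odot> v | c d. hyperbola c d}"
      unfolding eq using hyperbola_ecosh_esinh by blast
    show "{c \<odot> u + d \<odot> v | c d. hyperbola c d} \<subseteq> supergeodesic_of u v"
      unfolding eq by (blast elim: hyperbola_imp_ecosh_esinh)
  qed
qed

text \<open>The new frame arises by a Lorentz boost in the span of \<open>u\<close> and
  \<open>v\<close>, with \<open>k\<close> as the orientation sign.\<close>

lemma rotate_frame:
  assumes uv: "frame u v" and cd: "hyperbola c d" and k: "k * k = 1"
  defines "p \<equiv> c \<odot> u + d \<odot> v" and "t \<equiv> k \<odot> (d \<odot> u + c \<odot> v)"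
  shows "frame p t" "supergeodesic_of p t \<subseteq> supergeodesic_of u v"
proof -
  note f = uv[unfolded frame_iff]
  have "pairing p p = of_even (c * c - d * d)"
    using f by (simp add: p_def pairing_linear)
  then have pp: "pairing p p = 1" using hyperbolaD(1)[OF cd] by simp
  let ?q = "d \<odot> u + c \<odot> v"
  have "pairing ?q ?q = of_even (d * d - c * c)"
    using f by (simp add: pairing_linear)
  also have "d * d - c * c = - 1" using hyperbolaD(1)[OF cd] by (simp add: algebra_simps)
  finally have "pairing t t = of_even (- (k * k))"
    by (simp add: t_def pairing_emult)
  then have tt: "pairing t t = - 1" using k by simp
  have "pairing p ?q = of_even (c * d - d * c)" "pairing ?q p = of_even (d * c - c * d)"
    using f by (simp_all add: p_def pairing_linear of_even_commute[of "of_even d" c])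
  then have pt: "pairing p t = 0" "pairing t p = 0"
    by (simp_all add: t_def pairing_emult mult.commute)
  \<comment> \<open>In the null directions \<open>u + v\<close> and \<open>u - v\<close> the
    coefficients and the heights are all positive.\<close>
  have "2 * height (body_point p) =
      ebody (c + d) * height (body_point (u + v)) + ebody (c - d) * height (body_point (u - v))"
    by (simp add: p_def body_point_linear height_linear algebra_simps)
  also have "\<dots> > 0"
    using hyperbolaD(3,4)[OF cd] frame_light_cone[OF uv]
    by (simp only: light_cone_iff) (simp add: add_pos_pos)
  finally show "frame p t"
    using f pp tt pt by (simp add: frame_iff p_def t_def)
  show "supergeodesic_of p t \<subseteq> supergeodesic_of u v"
  proof
    fix x assume "x \<in> supergeodesic_of p t"
    then obtain a b where ab: "hyperbola a b" and x: "x = a \<odot> p + b \<odot> t"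
      by (auto simp: supergeodesic_of_eq)
    define b' where "b' = b * k"
    have "b' * b' = b * b * (k * k)" by (simp only: b'_def mult_ac)
    then have "(a + b') * (a - b') = (a + b) * (a - b)" using k by (simp add: algebra_simps)
    then have ab': "hyperbola a b'" using ab by (simp add: hyperbola_def)
    have "2 * ebody (a * c + b' * d) =
        ebody (a + b') * ebody (c + d) + ebody (a - b') * ebody (c - d)"
      by (simp add: algebra_simps)
    also have "\<dots> > 0"
      by (intro add_pos_pos mult_pos_pos hyperbolaD(3,4)[OF cd] hyperbolaD(3,4)[OF ab'])
    finally have "ebody (a * c + b' * d) > 0" by linarith
    moreover have "(a * c + b' * d + (a * d + b' * c)) * (a * c + b' * d - (a * d + b' * c)) =
        ((a + b') * (a - b')) * ((c + d) * (c - d))"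
      by (simp add: algebra_simps)
    \<comment> \<open>These coefficients are the addition formulas for cosh and sinh;
      \<open>b'\<close> is \<open>b\<close> with the orientation absorbed.\<close>
    ultimately have "hyperbola (a * c + b' * d) (a * d + b' * c)"
      using cd ab' by (simp add: hyperbola_def)
    moreover have "x = (a * c + b' * d) \<odot> u + (a * d + b' * c) \<odot> v"
      by (simp add: x p_def t_def b'_def emult_add emult_emult mult.assoc)
    ultimately show "x \<in> supergeodesic_of u v" unfolding supergeodesic_of_eq by blast
  qed
qed

text \<open>The inverse of a boost, with parameters \<open>c\<close> and \<open>- (k * d)\<close>,
  is again of this form, so the inclusion of \<open>rotate_frame\<close> holds both ways.\<close>

lemma rotate_supergeodesic:
  assumes "frame u v" "hyperbola c d" "k * k = 1"
  shows "supergeodesic_of (c \<odot> u + d \<odot> v) (k \<odot> (d \<odot> u + c \<odot> v)) = supergeodesic_of u v"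
    (is "supergeodesic_of ?p ?t = _")
proof
  show "supergeodesic_of ?p ?t \<subseteq> supergeodesic_of u v" using assms by (rule rotate_frame)
  let ?d = "- (k * d)"
  have cd: "c * c - d * d = 1" using hyperbolaD(1)[OF assms(2)] .
  have "hyperbola c ?d"
    using cd assms(2,3) by (simp add: hyperbola_def algebra_simps)
  moreover have "c \<odot> ?p + ?d \<odot> ?t = u"
  proof -
    have "c \<odot> ?p + ?d \<odot> ?t = (c * c - d * d) \<odot> u + (c * d - d * c) \<odot> v"
      using assms(3) by (simp add: emult_add emult_diff emult_emult mult_ac)
    then show ?thesis using cd by (simp add: mult.commute)
  qed
  moreover have "k \<odot> (?d \<odot> ?p + c \<odot> ?t) = v"
  proof -
    have "k \<odot> (?d \<odot> ?p + c \<odot> ?t) = (c * d - d * c) \<odot> u + (c * c - d * d) \<odot> v"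
      using assms(3) by (simp add: emult_add emult_diff emult_emult mult_ac)
    then show ?thesis using cd by (simp add: mult.commute)
  qed
  ultimately show "supergeodesic_of u v \<subseteq> supergeodesic_of ?p ?t"
    using rotate_frame(2)[OF rotate_frame(1)[OF assms], of c ?d k] assms(3) by simp
qed

lemma hyperbola_1_0 [simp]: "hyperbola 1 0"
  by (simp add: hyperbola_def)

lemma frame_uminus: "frame u v \<Longrightarrow> frame u (- v)"
  and supergeodesic_of_uminus: "frame u v \<Longrightarrow> supergeodesic_of u (- v) = supergeodesic_of u v"
  using rotate_frame(1)[of u v 1 0 "- 1"] rotate_supergeodesic[of u v 1 0 "- 1"] by simp_all

lemma base_in_supergeodesic: "u \<in> supergeodesic_of u v"
proof -
  have "1 \<odot> u + 0 \<odot> v \<in> supergeodesic_of u v"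
    unfolding supergeodesic_of_eq using hyperbola_1_0 by blast
  then show ?thesis by simp
qed

text \<open>The point set determines its frame up to a boost and an orientation; this is the
  converse of \<open>rotate_supergeodesic\<close>.\<close>

lemma supergeodesic_of_eqD:
  assumes uv: "frame u v" and uv': "frame u' v'"
    and eq: "supergeodesic_of u v = supergeodesic_of u' v'"
  obtains c d k where "hyperbola c d" "k * k = 1"
    "u' = c \<odot> u + d \<odot> v" "v' = k \<odot> (d \<odot> u + c \<odot> v)"
proof -
  note f = uv[unfolded frame_iff] and f' = uv'[unfolded frame_iff]
  have "u' \<in> supergeodesic_of u v" unfolding eq by (rule base_in_supergeodesic)
  then obtain c d where cd: "hyperbola c d" and u': "u' = c \<odot> u + d \<odot> v"
    unfolding supergeodesic_of_eq by blast
  \<comment> \<open>The pair \<open>(sqrt 2, 1)\<close> gives a point of the set other than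
    \<open>u'\<close>, from which \<open>v'\<close> is recovered as a combination of
    \<open>u\<close> and \<open>v\<close>.\<close>
  have "of_real (sqrt 2) * of_real (sqrt 2) = (of_real (sqrt 2 * sqrt 2) :: even_supernumber)"
    by (simp only: of_real_mult)
  then have "hyperbola (of_real (sqrt 2)) 1"
    by (simp add: hyperbola_def algebra_simps)
  then have "of_real (sqrt 2) \<odot> u' + 1 \<odot> v' \<in> supergeodesic_of u' v'"
    unfolding supergeodesic_of_eq by blast
  then obtain a b where "of_real (sqrt 2) \<odot> u' + 1 \<odot> v' = a \<odot> u + b \<odot> v"
    unfolding eq[symmetric] unfolding supergeodesic_of_eq by blast
  then have "v' = a \<odot> u + b \<odot> v - of_real (sqrt 2) \<odot> u'"
    by (simp add: eq_diff_eq add.commute)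
  also have "\<dots> = (a - of_real (sqrt 2) * c) \<odot> u + (b - of_real (sqrt 2) * d) \<odot> v"
    by (simp add: u' emult_add emult_diff emult_emult)
  finally obtain a b where v': "v' = a \<odot> u + b \<odot> v" by blast
  have "pairing u' v' = of_even (c * a - d * b)" "pairing v' v' = of_even (a * a - b * b)"
    using f by (simp_all add: u' v' pairing_linear of_even_commute[of "of_even a" c]
        of_even_commute[of "of_even b" d])
  then have "of_even (c * a - d * b) = of_even 0" "of_even (a * a - b * b) = of_even (- 1)"
    using f' by simp_all
  then have 0: "c * a = d * b" and 1: "a * a - b * b = - 1"
    unfolding of_even_eq_iff by simp_all
  have cc: "c * c - d * d = 1" by (rule hyperbolaD(1)[OF cd])
  \<comment> \<open>As \<open>(a, b)\<close> is Lorentz orthogonal to \<open>(c, d)\<close>, it is a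
    multiple of \<open>(d, c)\<close>, and the determinant is the factor.\<close>
  define k where "k = b * c - a * d"
  have "k * d = b * c * d - a * (d * d)" by (simp add: k_def algebra_simps)
  also have "\<dots> = c * (d * b) - a * (d * d)" by (simp add: algebra_simps)
  also have "\<dots> = a * (c * c - d * d)" unfolding 0[symmetric] by (simp add: algebra_simps)
  finally have kd: "k * d = a" using cc by simp
  have "k * c = b * (c * c) - d * (c * a)" by (simp add: k_def algebra_simps)
  also have "\<dots> = b * (c * c - d * d)" unfolding 0 by (simp add: algebra_simps)
  finally have kc: "k * c = b" using cc by simp
  have "k * k * (c * c - d * d) = (k * c) * (k * c) - (k * d) * (k * d)" by (simp add: algebra_simps)
  also have "\<dots> = - (a * a - b * b)" unfolding kc kd by simp
  finally have "k * k = 1" unfolding cc 1 by simp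
  moreover have "v' = k \<odot> (d \<odot> u + c \<odot> v)" by (simp add: v' emult_add emult_emult kc kd)
  ultimately show ?thesis using that cd u' by blast
qed

text \<open>Every point can serve as the base point of a frame, so only parameter \<open>0\<close>
  has to be considered.\<close>

lemma unit_tangent_iff:
  "unit_tangent L p t \<longleftrightarrow> frame p t \<and> L = supergeodesic_of p t"
proof -
  have geo: "geo_point u v (of_even s) = ecosh s \<odot> u + esinh s \<odot> v"
    "geo_tangent u v (of_even s) = 1 \<odot> (esinh s \<odot> u + ecosh s \<odot> v)" for u v s
    by (simp_all add: geo_point_def geo_tangent_def super_ext_cosh super_ext_sinh emult_def
        ecosh_def esinh_def del: emult_simps(1)) (simp add: emult_simps(1)[unfolded emult_def of_even_simps])
  show ?thesis
  proof
    assume "unit_tangent L p t"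
    then obtain u v s where uv: "frame u v" "L = supergeodesic_of u v"
      and "p = geo_point u v (of_even s)" "t = geo_tangent u v (of_even s)"
      unfolding unit_tangent_def by (metis of_even_cases)
    then show "frame p t \<and> L = supergeodesic_of p t"
      using rotate_frame(1)[OF uv(1) hyperbola_ecosh_esinh, of 1 s]
        rotate_supergeodesic[OF uv(1) hyperbola_ecosh_esinh, of 1 s]
      by (simp only: geo) simp
  next
    assume "frame p t \<and> L = supergeodesic_of p t"
    moreover have "p = geo_point p t (of_even 0)" "t = geo_tangent p t (of_even 0)"
      unfolding geo by (simp_all add: ecosh_def esinh_def flip: scaleR_2)
    ultimately show "unit_tangent L p t"
      unfolding unit_tangent_def using of_even by metis
  qed
qed

lemma perpendicular_iff:
  "perpendicular L L' \<longleftrightarrow> (\<exists>p t t'. frame p t \<and> frame p t' \<and> L = supergeodesic_of p t \<and>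
    L' = supergeodesic_of p t' \<and> pairing t t' = 0)"
  unfolding perpendicular_def unit_tangent_iff frame_def by blast

section \<open>Common perpendiculars\<close>

text \<open>This is a Gram-Schmidt step: the part of \<open>q\<close> orthogonal to \<open>p\<close>
  has square \<open>1 - f * f\<close>, whose body is negative by \<open>unit_pairing_gt_1\<close>,
  so it can be normalized.\<close>

lemma connecting_frame:
  assumes p: "p \<in> super_H" and q: "q \<in> super_H" and ne: "body_point p \<noteq> body_point q"
  obtains f g w where "frame p w" "hyperbola f g" "ebody g > 0" "q = f \<odot> p + g \<odot> w"
proof -
  note pq = p[unfolded super_H_iff] q[unfolded super_H_iff]
  obtain f where f: "pairing p q = of_even f" using pq by (auto elim: pairing_evenE)
  have "ebody f = real_pairing (body_point p) (body_point q)"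
    using body_pairing[of p q] pq f by (simp add: ebody_def)
  also have "\<dots> > 1"
    using pq ne body_pairing[of p p] body_pairing[of q q] by (intro unit_pairing_gt_1) auto
  finally have f1: "ebody f > 1" .
  then have "1 * 1 < ebody f * ebody f" by (intro mult_strict_mono) auto
  then have "ebody (f * f - 1) > 0" by simp
  then obtain l where l: "eexp l = f * f - 1" by (rule eexp_surj)
  \<comment> \<open>Half the logarithm of \<open>f * f - 1\<close> yields its square root
    \<open>g\<close> and the inverse \<open>h\<close> of \<open>g\<close>.\<close>
  define g where "g = eexp (l /\<^sub>R 2)"
  define h where "h = eexp (- (l /\<^sub>R 2))"
  have "l /\<^sub>R 2 + l /\<^sub>R 2 = l" by (simp flip: scaleR_left_distrib)
  then have gg: "g * g = f * f - 1" by (simp add: g_def l flip: eexp_add)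
  have gh: "g * h = 1" by (simp add: g_def h_def eexp_minus)
  have fg: "hyperbola f g" using gg f1 by (simp add: hyperbola_def algebra_simps)
  define w where "w = h \<odot> (q - f \<odot> p)"
  have pq1: "pairing q p = of_even f" using f pairing_commute[of p q] pq by simp
  have "g \<odot> w = q - f \<odot> p" using gh by (simp add: w_def emult_emult)
  then have qw: "q = f \<odot> p + g \<odot> w" by simp
  have "pairing (q - f \<odot> p) (q - f \<odot> p) = of_even (1 - f * f)"
    using pq f pq1 by (simp add: pairing_linear)
  also have "1 - f * f = - (g * g)" using gg by simp
  finally have "pairing w w = of_even (- ((g * h) * (g * h)))"
    unfolding w_def pairing_emult by (simp only: of_even_simps(6)[symmetric] of_even_eq_iff) (simp add: mult_ac)
  moreover have "pairing p w = 0" "pairing w p = 0"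
    using pq f pq1 by (simp_all add: w_def pairing_linear)
  ultimately have "frame p w"
    using pq gh by (simp add: frame_iff w_def)
  moreover have "ebody g > 0" by (simp add: g_def)
  ultimately show ?thesis using that fg qw by blast
qed

text \<open>Pairing \<open>q\<close> with \<open>p\<close> recovers the first coefficient; the
  second is then known up to sign and can be cancelled, so the tangents agree up to sign.\<close>

lemma supergeodesic_unique:
  assumes pt: "frame p t" and pt': "frame p t'"
    and q: "q = c \<odot> p + d \<odot> t" "q = c' \<odot> p + d' \<odot> t'"
    and cd: "hyperbola c d" "hyperbola c' d'" and ne: "body_point p \<noteq> body_point q"
  shows "supergeodesic_of p t = supergeodesic_of p t'"
proof -
  note f = pt[unfolded frame_iff] pt'[unfolded frame_iff]
  have "pairing q p = of_even c" "pairing q p = of_even c'"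
    using f by (simp add: q(1) pairing_linear, simp add: q(2) pairing_linear)
  then have c: "c = c'" by simp
  have dt: "d \<odot> t = d' \<odot> t'" using q unfolding c by simp
  have "d\<^sup>2 = d'\<^sup>2"
    using cd[THEN hyperbolaD(1)] c by (simp add: power2_eq_square algebra_simps)
  moreover have "ebody d' \<noteq> 0"
  proof
    \<comment> \<open>Then \<open>c'\<close> has body \<open>1\<close>, so \<open>p\<close> and
      \<open>q\<close> would have the same body.\<close>
    assume d': "ebody d' = 0"
    have "ebody c' * ebody c' = 1" "ebody c' > 0"
      using hyperbolaD(2)[OF cd(2)] d' cd(2) by (auto simp: hyperbola_def)
    then have "ebody c' = 1" by (metis abs_of_pos abs_square_eq_1 power2_eq_square)
    then have "body_point q = body_point p" by (simp add: q(2) body_point_linear d')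
    then show False using ne by simp
  qed
  ultimately have dd': "d = d' \<or> d = - d'" by (rule square_eq_square_cases)
  then have "t = t' \<or> t = - t'"
  proof
    assume "d = d'"
    then show ?thesis using dt emult_cancel[OF \<open>ebody d' \<noteq> 0\<close>] by simp
  next
    assume "d = - d'"
    then have "d' \<odot> (- t) = d' \<odot> t'" using dt by simp
    then have "- t = t'" by (rule emult_cancel[OF \<open>ebody d' \<noteq> 0\<close>])
    then show ?thesis by auto
  qed
  then show ?thesis using supergeodesic_of_uminus[OF pt'] by auto
qed

section \<open>Critical points of the pairing\<close>

text \<open>
  With \<open>p\<^sub>i = c\<^sub>i u\<^sub>i + d\<^sub>i v\<^sub>i\<close> and \<open>t\<^sub>i = d\<^sub>i u\<^sub>i + c\<^sub>i v\<^sub>i\<close>, the two equations below say that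
  \<open>\<langle>t\<^sub>1, p\<^sub>2\<rangle> = \<langle>p\<^sub>1, t\<^sub>2\<rangle> = 0\<close>, that is, the pairing of a point of one supergeodesic with a point of the
  other is critical at \<open>(p\<^sub>1, p\<^sub>2)\<close>.
\<close>

definition critical ::
    "even_supernumber \<Rightarrow> even_supernumber \<Rightarrow> even_supernumber \<Rightarrow> even_supernumber \<Rightarrow>
     even_supernumber \<Rightarrow> even_supernumber \<Rightarrow> even_supernumber \<Rightarrow> even_supernumber \<Rightarrow> bool" where
  "critical A B C D c1 d1 c2 d2 \<longleftrightarrow>
     A * d1 * c2 + B * d1 * d2 + C * c1 * c2 + D * c1 * d2 = 0 \<and>
     A * c1 * d2 + B * c1 * c2 + C * d1 * d2 + D * d1 * c2 = 0"

text \<open>In the coordinates \<open>c\<^sub>i + d\<^sub>i\<close> and \<open>c\<^sub>i - d\<^sub>i = 1 / (c\<^sub>i + d\<^sub>i)\<close> the equations become binomial.\<close>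

lemma critical_iff:
  "critical A B C D c1 d1 c2 d2 \<longleftrightarrow>
     (A + B + C + D) * ((c1 + d1) * (c2 + d2)) = (A - B - C + D) * ((c1 - d1) * (c2 - d2)) \<and>
     (A - B + C - D) * ((c1 + d1) * (c2 - d2)) = (A + B - C - D) * ((c1 - d1) * (c2 + d2))"
  (is "_ \<longleftrightarrow> ?l1 = ?r1 \<and> ?l2 = ?r2")
proof -
  let ?e1 = "A * d1 * c2 + B * d1 * d2 + C * c1 * c2 + D * c1 * d2"
  let ?e2 = "A * c1 * d2 + B * c1 * c2 + C * d1 * d2 + D * d1 * c2"
  \<comment> \<open>The binomial equations are the sum and the difference of the critical equations,
    up to the invertible factor 2.\<close>
  have "?l1 - ?r1 = 2 *\<^sub>R (?e1 + ?e2)" "?l2 - ?r2 = 2 *\<^sub>R (?e1 - ?e2)"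
    by (simp_all add: scaleR_2 algebra_simps)
  then have "?l1 = ?r1 \<longleftrightarrow> ?e1 + ?e2 = 0" "?l2 = ?r2 \<longleftrightarrow> ?e1 - ?e2 = 0"
    by (metis right_minus_eq scaleR_eq_0_iff zero_neq_numeral)+
  moreover have "?e1 + ?e2 = 0 \<and> ?e1 - ?e2 = 0 \<longleftrightarrow> ?e1 = 0 \<and> ?e2 = 0"
    using add_diff_eqD[of ?e1 ?e2 0 0] by auto
  ultimately show ?thesis unfolding critical_def by blast
qed

lemma hyperbola_of_eexp:
  obtains c d where "hyperbola c d" "c + d = eexp s" "c - d = eexp (- s)"
  using that[OF hyperbola_ecosh_esinh ecosh_plus_esinh ecosh_minus_esinh] .

text \<open>For \<open>c1 + d1 = eexp s\<close> and \<open>c2 + d2 = eexp r\<close>, logarithms turn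
  the binomial equations into a linear system for \<open>s + r\<close> and
  \<open>s - r\<close>.\<close>

lemma critical_exists:
  assumes "ebody (A + B + C + D) > 0" "ebody (A - B + C - D) > 0"
    and "ebody (A + B - C - D) > 0" "ebody (A - B - C + D) > 0"
  obtains c1 d1 c2 d2 where "hyperbola c1 d1" "hyperbola c2 d2" "critical A B C D c1 d1 c2 d2"
proof -
  obtain a b c d where abcd: "eexp a = A + B + C + D" "eexp b = A - B + C - D"
    "eexp c = A + B - C - D" "eexp d = A - B - C + D"
    using assms by (elim eexp_surj)
  have half: "(1 / 2) *\<^sub>R x + (1 / 2) *\<^sub>R x = x" for x :: even_supernumber
    by (simp flip: scaleR_left_distrib)
  define m n where "m = (1 / 2) *\<^sub>R (d - a)" and "n = (1 / 2) *\<^sub>R (c - b)"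
  define s r where "s = (1 / 2) *\<^sub>R m + (1 / 2) *\<^sub>R n" and "r = (1 / 2) *\<^sub>R m - (1 / 2) *\<^sub>R n"
  have sr: "s + r = m" "s - r = n"
    using half[of m] half[of n] by (simp_all add: s_def r_def)
  have "a + (s + r) = d - (s + r)" "b + (s - r) = c - (s - r)"
    unfolding eq_diff_eq add.assoc sr m_def n_def half by simp_all
  then have e: "a + (s + r) = d + (- s + - r)" "b + (s + - r) = c + (- s + r)"
    by (simp_all add: algebra_simps)
  obtain c1 d1 where 1: "hyperbola c1 d1" "c1 + d1 = eexp s" "c1 - d1 = eexp (- s)"
    by (rule hyperbola_of_eexp)
  obtain c2 d2 where 2: "hyperbola c2 d2" "c2 + d2 = eexp r" "c2 - d2 = eexp (- r)"
    by (rule hyperbola_of_eexp)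
  have "critical A B C D c1 d1 c2 d2"
    unfolding critical_iff 1 2 abcd[symmetric] eexp_add[symmetric] e by simp
  then show ?thesis using that 1 2 by blast
qed

text \<open>The equations fix the square of \<open>X * Y\<close> and the ratio of the squares of
  \<open>X\<close> and \<open>Y\<close>; uniqueness of positive square roots does the rest.\<close>

lemma critical_unique:
  assumes pos: "ebody (A + B + C + D) > 0" "ebody (A - B + C - D) > 0"
    and 1: "hyperbola c1 d1" "hyperbola c2 d2" "critical A B C D c1 d1 c2 d2"
    and 2: "hyperbola c1' d1'" "hyperbola c2' d2'" "critical A B C D c1' d1' c2' d2'"
  shows "c1 = c1'" "d1 = d1'" "c2 = c2'" "d2 = d2'"
proof -
  define X where "X = c1 + d1"
  define Y where "Y = c2 + d2"
  define Z where "Z = c1' + d1'"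
  define W where "W = c2' + d2'"
  have XYZW: "ebody X > 0" "ebody Y > 0" "ebody Z > 0" "ebody W > 0"
    using 1 2 hyperbolaD(3) unfolding X_def Y_def Z_def W_def by blast+
  \<comment> \<open>Multiplying both binomial equations by \<open>x * x'\<close> clears the inverses
    \<open>y\<close> and \<open>y'\<close>.\<close>
  have *: "(A + B + C + D) * ((c + d) * (c' + d'))\<^sup>2 = A - B - C + D"
    "(A - B + C - D) * (c + d)\<^sup>2 = (A + B - C - D) * (c' + d')\<^sup>2"
    if h: "hyperbola c d" "hyperbola c' d'" "critical A B C D c d c' d'" for c d c' d'
  proof -
    define x y x' y' where "x = c + d" and "y = c - d" and "x' = c' + d'" and "y' = c' - d'"
    note defs = x_def[symmetric] y_def[symmetric] x'_def[symmetric] y'_def[symmetric]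
    have xy: "x * y = 1" "x' * y' = 1" using h unfolding hyperbola_def defs by auto
    have cr: "(A + B + C + D) * (x * x') = (A - B - C + D) * (y * y')"
      "(A - B + C - D) * (x * y') = (A + B - C - D) * (y * x')"
      using h(3) unfolding critical_iff defs by auto
    have "(A + B + C + D) * (x * x')\<^sup>2 = ((A + B + C + D) * (x * x')) * (x * x')"
      by (simp only: power2_eq_square mult.assoc)
    also have "\<dots> = (A - B - C + D) * ((x * y) * (x' * y'))"
      unfolding cr by (simp only: mult_ac)
    finally have 1: "(A + B + C + D) * (x * x')\<^sup>2 = A - B - C + D" unfolding xy by simp
    have "(A - B + C - D) * x\<^sup>2 * (x' * y') = ((A - B + C - D) * (x * y')) * (x * x')"
      by (simp only: power2_eq_square mult_ac)
    also have "\<dots> = (A + B - C - D) * x'\<^sup>2 * (x * y)"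
      unfolding cr by (simp only: power2_eq_square mult_ac)
    finally have "(A - B + C - D) * x\<^sup>2 = (A + B - C - D) * x'\<^sup>2" unfolding xy by simp
    with 1 show "(A + B + C + D) * ((c + d) * (c' + d'))\<^sup>2 = A - B - C + D"
      "(A - B + C - D) * (c + d)\<^sup>2 = (A + B - C - D) * (c' + d')\<^sup>2" unfolding defs by auto
  qed
  note e = *[OF 1, folded X_def Y_def] *[OF 2, folded Z_def W_def]
  have "(A + B + C + D) * ((X * Y)\<^sup>2 - (Z * W)\<^sup>2) = 0"
    unfolding right_diff_distrib e by simp
  then have "(X * Y)\<^sup>2 - (Z * W)\<^sup>2 = 0" by (rule mult_eq_0_even[rotated]) (use pos in auto)
  then have XY: "X * Y = Z * W" using XYZW pos_square_inj[of "X * Y" "Z * W"] by simp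
  \<comment> \<open>The equality of the ratios \<open>X / Y\<close> and \<open>Z / W\<close> is
    proved in cross-multiplied form.\<close>
  have "(A - B + C - D) * ((X * W)\<^sup>2 - (Z * Y)\<^sup>2) =
      ((A - B + C - D) * X\<^sup>2) * W\<^sup>2 - ((A - B + C - D) * Z\<^sup>2) * Y\<^sup>2"
    by (simp add: algebra_simps)
  also have "\<dots> = 0" unfolding e by (simp add: mult_ac)
  finally have "(X * W)\<^sup>2 - (Z * Y)\<^sup>2 = 0" by (rule mult_eq_0_even[rotated]) (use pos in auto)
  then have XW: "X * W = Z * Y" using XYZW pos_square_inj[of "X * W" "Z * Y"] by simp
  have cancel: "x = y" if "ebody w > 0" "w * x = w * y" for w x y
    using mult_eq_0_even[of w "x - y"] that by (simp add: algebra_simps)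
  have "(Y * W) * X\<^sup>2 = (X * Y) * (X * W)" by (simp only: power2_eq_square mult_ac)
  also have "\<dots> = (Y * W) * Z\<^sup>2" unfolding XY XW by (simp only: power2_eq_square mult_ac)
  finally have "X\<^sup>2 = Z\<^sup>2" by (rule cancel[rotated]) (use XYZW in simp)
  then have "X = Z" using XYZW pos_square_inj[of X Z] by simp
  then have "Y = W" using XY cancel XYZW by blast
  show "c1 = c1'" "d1 = d1'" "c2 = c2'" "d2 = d2'"
    using \<open>X = Z\<close> \<open>Y = W\<close> hyperbola_eqI[OF 1(1) 2(1)] hyperbola_eqI[OF 1(2) 2(2)]
    unfolding X_def Y_def Z_def W_def by blast+
qed

section \<open>Pairings of the asymptotes\<close>

lemma body_ray: "body_point ` ray w = (\<lambda>r. r *\<^sub>R body_point w) ` {0<..}"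
proof -
  have "ray w = (\<lambda>c. c \<odot> w) ` {c. ebody c > 0}"
    unfolding ray_def even_supernumbers_eq_range ebody_def emult_def by blast
  then have "body_point ` ray w = (\<lambda>r. r *\<^sub>R body_point w) ` ebody ` {c. ebody c > 0}"
    by (simp add: image_image body_point_linear)
  moreover have "ebody ` {c. ebody c > 0} = {0<..}"
    using image_eqI[where f = ebody, OF ebody_of_real[symmetric]] by auto
  ultimately show ?thesis by simp
qed

lemma ray_subset_light_cone:
  assumes "w \<in> light_cone"
  shows "ray w \<subseteq> light_cone"
proof
  fix x assume "x \<in> ray w"
  then obtain c where "x = c \<odot> w" "ebody c > 0"
    unfolding ray_def ebody_def emult_def by (auto elim: of_even_cases)
  then show "x \<in> light_cone"
    using assms by (simp add: light_cone_iff pairing_linear body_point_linear height_linear)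
qed

text \<open>A nonpositive body would make the bodies of the two null vectors proportional by
  \<open>null_pairing_pos\<close>, so the asymptotic rays would have the same body.\<close>

lemma not_ultraparallel_pairing_pos:
  assumes f1: "frame u1 v1" and f2: "frame u2 v2"
    and par: "parallel (supergeodesic_of u1 v1) (supergeodesic_of u2 v2)"
    and nonultra: "\<not> ultraparallel (supergeodesic_of u1 v1) (supergeodesic_of u2 v2)"
    and a: "pairing (u1 + v1) (u2 + v2) = of_even a"
  shows "ebody a > 0"
proof (rule ccontr)
  let ?n1 = "body_point (u1 + v1)" and ?n2 = "body_point (u2 + v2)"
  assume "\<not> ebody a > 0"
  note n = frame_light_cone(1)[OF f1] frame_light_cone(1)[OF f2]
  note m = n[unfolded light_cone_iff]
  have "real_pairing ?n1 ?n2 \<le> 0" "real_pairing ?n1 ?n1 = 0" "real_pairing ?n2 ?n2 = 0"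
    using \<open>\<not> ebody a > 0\<close> m a by (auto simp: ebody_def simp flip: body_pairing)
  then obtain r where r: "r > 0" "?n2 = r *\<^sub>R ?n1"
    using m by (metis null_pairing_pos)
  have "body_point ` ray (u1 + v1) = body_point ` ray (u2 + v2)"
    unfolding body_ray r
  proof (rule subset_antisym; rule image_subsetI)
    fix s :: real assume "s \<in> {0<..}"
    then show "s *\<^sub>R ?n1 \<in> (\<lambda>s'. s' *\<^sub>R r *\<^sub>R ?n1) ` {0<..}"
      using r(1) by (intro image_eqI[of _ _ "s / r"]) auto
    show "s *\<^sub>R r *\<^sub>R ?n1 \<in> (\<lambda>s'. s' *\<^sub>R ?n1) ` {0<..}"
      using r(1) \<open>s \<in> {0<..}\<close> by (intro image_eqI[of _ _ "s * r"]) auto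
  qed
  moreover have "asymptotic_ray (supergeodesic_of u v) (ray (u + v))" if "frame u v" for u v
    unfolding asymptotic_ray_def using that by blast
  ultimately have "ultraparallel (supergeodesic_of u1 v1) (supergeodesic_of u2 v2)"
    unfolding ultraparallel_def using f1 f2 par n[THEN ray_subset_light_cone] by blast
  then show False using nonultra by simp
qed

text \<open>The four combinations are the pairings of \<open>u1 + v1\<close> and
  \<open>u1 - v1\<close> with \<open>u2 + v2\<close> and \<open>u2 - v2\<close>; reversing tangents
  reduces all to one case.\<close>

lemma frames_pairing_pos:
  assumes f: "frame u1 v1" "frame u2 v2"
    and par: "parallel (supergeodesic_of u1 v1) (supergeodesic_of u2 v2)"
    and nonultra: "\<not> ultraparallel (supergeodesic_of u1 v1) (supergeodesic_of u2 v2)"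
    and ABCD: "pairing u1 u2 = of_even A" "pairing u1 v2 = of_even B"
      "pairing v1 u2 = of_even C" "pairing v1 v2 = of_even D"
  shows "ebody (A + B + C + D) > 0" "ebody (A - B + C - D) > 0"
    "ebody (A + B - C - D) > 0" "ebody (A - B - C + D) > 0"
proof -
  note f' = f[THEN frame_uminus]
  note u = f[THEN supergeodesic_of_uminus]
  show "ebody (A + B + C + D) > 0"
    by (rule not_ultraparallel_pairing_pos[OF f]) (use par nonultra ABCD in \<open>simp_all add: pairing_linear\<close>)
  show "ebody (A - B + C - D) > 0"
    by (rule not_ultraparallel_pairing_pos[OF f(1) f'(2)])
      (use par nonultra ABCD u in \<open>simp_all add: pairing_linear\<close>)
  show "ebody (A + B - C - D) > 0"
    by (rule not_ultraparallel_pairing_pos[OF f'(1) f(2)])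
      (use par nonultra ABCD u in \<open>simp_all add: pairing_linear\<close>)
  show "ebody (A - B - C + D) > 0"
    by (rule not_ultraparallel_pairing_pos[OF f'])
      (use par nonultra ABCD u in \<open>simp_all add: pairing_linear\<close>)
qed

lemma frame_span_orthogonal:
  assumes "frame p t" "x \<in> supergeodesic_of p t" "pairing p y = 0" "pairing t y = 0"
  shows "pairing x y = 0"
  using assms(2-4) by (auto simp: supergeodesic_of_eq pairing_linear)

section \<open>Existence and uniqueness of the common perpendicular\<close>

theorem theorem6p5:
  fixes u1 v1 u2 v2 :: superpoint and L1 L2 :: "superpoint set"
  assumes "u1 \<in> super_H" and "v1 \<in> super_D" and "pairing u1 v1 = 0"
    and "u2 \<in> super_H" and "v2 \<in> super_D" and "pairing u2 v2 = 0"
    and "L1 = supergeodesic_of u1 v1" and "L2 = supergeodesic_of u2 v2"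
    and "parallel L1 L2" and "\<not> ultraparallel L1 L2"
  shows "\<exists>!L. supergeodesic L \<and> perpendicular L L1 \<and> perpendicular L L2"
proof -
  note L = assms(7,8) and par = assms(9,10)
  have fr: "frame u1 v1" "frame u2 v2" using assms by (simp_all add: frame_def)
  note f = fr[unfolded frame_iff]
  obtain A B C D where ABCD: "pairing u1 u2 = of_even A" "pairing u1 v2 = of_even B"
    "pairing v1 u2 = of_even C" "pairing v1 v2 = of_even D"
    using f pairing_evenE by metis
  note pos = frames_pairing_pos[OF fr par[unfolded L] ABCD]
  have pairings:
    "pairing (d1 \<odot> u1 + c1 \<odot> v1) (c2 \<odot> u2 + d2 \<odot> v2) =
      of_even (A * d1 * c2 + B * d1 * d2 + C * c1 * c2 + D * c1 * d2)"
    "pairing (c1 \<odot> u1 + d1 \<odot> v1) (d2 \<odot> u2 + c2 \<odot> v2) =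
      of_even (A * c1 * d2 + B * c1 * c2 + C * d1 * d2 + D * d1 * c2)" for c1 d1 c2 d2
    unfolding pairing_linear ABCD of_even_simps(3,6)[symmetric] of_even_eq_iff
    by (simp_all add: algebra_simps)
  \<comment> \<open>The critical point supplies the feet \<open>p1\<close> and \<open>p2\<close> of
    the perpendicular.\<close>
  obtain c1 d1 c2 d2 where hyp: "hyperbola c1 d1" "hyperbola c2 d2"
    and crit: "critical A B C D c1 d1 c2 d2"
    using critical_exists[OF pos] .
  define p1 t1 p2 t2 where "p1 = c1 \<odot> u1 + d1 \<odot> v1" and "t1 = d1 \<odot> u1 + c1 \<odot> v1"
    and "p2 = c2 \<odot> u2 + d2 \<odot> v2" and "t2 = d2 \<odot> u2 + c2 \<odot> v2"
  note defs = p1_def t1_def p2_def t2_def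
  have frt: "frame p1 t1" "frame p2 t2"
    using rotate_frame(1)[OF fr(1) hyp(1), of 1] rotate_frame(1)[OF fr(2) hyp(2), of 1]
    by (simp_all add: defs)
  have Lt: "L1 = supergeodesic_of p1 t1" "L2 = supergeodesic_of p2 t2"
    using rotate_supergeodesic[OF fr(1) hyp(1), of 1] rotate_supergeodesic[OF fr(2) hyp(2), of 1]
    by (simp_all add: defs L)
  have "pairing t1 p2 = 0" "pairing p1 t2 = 0"
    using crit unfolding defs pairings critical_def by simp_all
  moreover note g = frt[unfolded frame_iff]
  ultimately have orth: "pairing p2 t1 = 0" "pairing p1 t2 = 0"
    using pairing_commute[of t1 p2] by auto
  have "p1 \<in> L1" "p2 \<in> L2" unfolding Lt by (rule base_in_supergeodesic)+
  then have ne: "body_point p1 \<noteq> body_point p2" using par(1) unfolding parallel_def by blast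
  have "p1 \<in> super_H" "p2 \<in> super_H" using frt by (simp_all add: frame_def)
  then obtain a b w where w: "frame p1 w" "hyperbola a b" "ebody b > 0" "p2 = a \<odot> p1 + b \<odot> w"
    using connecting_frame ne by metis
  note w' = w(1)[unfolded frame_iff]
  \<comment> \<open>The body of \<open>b\<close> is positive, so \<open>b\<close> is invertible;
    since \<open>p2\<close> is \<open>a \<odot> p1 + b \<odot> w\<close>, orthogonality passes from
    \<open>p1\<close> and \<open>p2\<close> to \<open>w\<close>.\<close>
  have cancel: "x = 0" if "of_even b * x = 0" "x = of_even y" for x y
    using mult_eq_0_even[of b y] w(3) that by (metis less_irrefl of_even_eq_0_iff of_even_simps(6))
  have wt1: "pairing w t1 = 0"
  proof -
    have "of_even b * pairing w t1 = 0" using orth(1) g unfolding w(4) by (simp add: pairing_linear)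
    moreover obtain y where "pairing w t1 = of_even y" using g w' by (metis pairing_evenE)
    ultimately show ?thesis by (rule cancel)
  qed
  have wt2: "pairing w t2 = 0"
  proof -
    have "pairing (a \<odot> p1 + b \<odot> w) t2 = 0" using g by (simp flip: w(4))
    then have "of_even b * pairing w t2 = 0" using orth(2) by (simp add: pairing_linear)
    moreover obtain y where "pairing w t2 = of_even y" using g w' by (metis pairing_evenE)
    ultimately show ?thesis by (rule cancel)
  qed
  \<comment> \<open>This is the tangent at \<open>p2\<close> of the supergeodesic that leaves
    \<open>p1\<close> along \<open>w\<close>.\<close>
  define w2 where "w2 = b \<odot> p1 + a \<odot> w"
  have w2: "frame p2 w2" "supergeodesic_of p2 w2 = supergeodesic_of p1 w"
    using rotate_frame(1)[OF w(1,2), of 1] rotate_supergeodesic[OF w(1,2), of 1]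
    by (simp_all add: w(4) w2_def)
  show ?thesis
  proof (rule ex1I)
    have "perpendicular (supergeodesic_of p1 w) L1"
      unfolding perpendicular_iff using w(1) frt(1) Lt(1) wt1 by blast
    moreover have "pairing w2 t2 = 0" using orth(2) wt2 by (simp add: w2_def pairing_linear)
    then have "perpendicular (supergeodesic_of p1 w) L2"
      unfolding perpendicular_iff using w2 frt(2) Lt(2) by metis
    ultimately show "supergeodesic (supergeodesic_of p1 w) \<and>
        perpendicular (supergeodesic_of p1 w) L1 \<and> perpendicular (supergeodesic_of p1 w) L2"
      unfolding supergeodesic_def using w(1) by blast
  next
    fix M assume M: "supergeodesic M \<and> perpendicular M L1 \<and> perpendicular M L2"
    obtain q1 m1 s1 where 1: "frame q1 m1" "frame q1 s1" "M = supergeodesic_of q1 m1"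
      "L1 = supergeodesic_of q1 s1" "pairing m1 s1 = 0"
      using M unfolding perpendicular_iff by blast
    obtain q2 m2 s2 where 2: "frame q2 m2" "frame q2 s2" "M = supergeodesic_of q2 m2"
      "L2 = supergeodesic_of q2 s2" "pairing m2 s2 = 0"
      using M unfolding perpendicular_iff by blast
    note h = 1(1,2)[unfolded frame_iff] 2(1,2)[unfolded frame_iff]
    have mem: "q2 \<in> supergeodesic_of q1 m1" "q1 \<in> supergeodesic_of q2 m2"
      using base_in_supergeodesic 1(3) 2(3) by metis+
    \<comment> \<open>The foot \<open>q2\<close> lies in the span of \<open>q1\<close> and
      \<open>m1\<close>, both orthogonal to \<open>s1\<close>; likewise for \<open>q1\<close> and
      \<open>s2\<close>.\<close>
    have "pairing q2 s1 = 0" "pairing q1 s2 = 0"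
      using frame_span_orthogonal[OF 1(1) mem(1)] frame_span_orthogonal[OF 2(1) mem(2)] 1(5) 2(5) h
      by auto
    then have qs: "pairing s1 q2 = 0" "pairing q1 s2 = 0"
      using pairing_commute[of q2 s1] h by auto
    obtain e1 f1 k1 where e1: "hyperbola e1 f1" "k1 * k1 = 1"
      "q1 = e1 \<odot> u1 + f1 \<odot> v1" "s1 = k1 \<odot> (f1 \<odot> u1 + e1 \<odot> v1)"
      using supergeodesic_of_eqD[OF fr(1) 1(2)] 1(4) L(1) by metis
    obtain e2 f2 k2 where e2: "hyperbola e2 f2" "k2 * k2 = 1"
      "q2 = e2 \<odot> u2 + f2 \<odot> v2" "s2 = k2 \<odot> (f2 \<odot> u2 + e2 \<odot> v2)"
      using supergeodesic_of_eqD[OF fr(2) 2(2)] 2(4) L(2) by metis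
    have sign_cancel: "x = 0" if "k * k = 1" "of_even k * of_even x = 0" for k x
      using that by (metis mult.assoc mult_1 mult_zero_right of_even_eq_0_iff of_even_simps(6))
    \<comment> \<open>The orientations \<open>k1\<close> and \<open>k2\<close> drop out, so the feet
      of \<open>M\<close> also form a critical point.\<close>
    have "critical A B C D e1 f1 e2 f2"
      using sign_cancel[OF e1(2)] sign_cancel[OF e2(2)] qs
      unfolding critical_def e1(3,4) e2(3,4) pairing_emult pairings by blast
    then have "q1 = p1" "q2 = p2"
      using critical_unique[OF pos(1,2) hyp crit e1(1) e2(1)] e1(3) e2(3) by (simp_all add: defs)
    \<comment> \<open>Now \<open>M\<close> joins \<open>p1\<close> to \<open>p2\<close>, whose
      bodies differ, so it is the supergeodesic found before.\<close>
    obtain a' b' where "hyperbola a' b'" "p2 = a' \<odot> p1 + b' \<odot> m1"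
      using mem(1) \<open>q1 = p1\<close> \<open>q2 = p2\<close> unfolding supergeodesic_of_eq by blast
    then show "M = supergeodesic_of p1 w"
      using supergeodesic_unique[OF w(1) _ w(4) _ w(2) _ ne] 1(1,3) \<open>q1 = p1\<close> by metis
  qed
qed

end
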